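(* (In $\mathsf{ZF}$.) Let $X$ be an amorphous set. Then either $X$ is $\mathrm{R}^n$-finite for all $n\in\mathbb N\setminus\{1\}$, or $X$ is $\mathrm{R}^n$-infinite for all $n\in\mathbb N$.
   Context: Work in $\mathsf{ZF}$, without the Axiom of Choice. $\mathbb N=\{1,2,3,\dots\}$. A set is finite if it is in bijection with some $n\in\omega$, and infinite otherwise. A set $X$ is amorphous if it is infinite and every subset of $X$ is either finite or has finite complement in $X$. $[X]^n$ is the set of $n$-element subsets of $X$, and $2=\{0,1\}$. For $n\in\mathbb N$, a set $X$ is $\mathrm{R}^n$-finite if there exists a colouring $c:[X]^n\to 2$ such that for every infinite $Y\subseteq X$ the restriction $c\upharpoonright[Y]^n$ is not constant; $X$ is $\mathrm{R}^n$-infinite if it is not $\mathrm{R}^n$-finite. *)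

theory Defs
  imports Main
begin

text \<open>
  HOL proves the axiom of choice, so no HOL set is amorphous and a rendering in terms of HOL
  sets would hold vacuously. A theorem of \<open>ZF\<close> is therefore rendered as a statement that holds in
  every model of first-order \<open>ZF\<close>. A model is a type with a binary relation, and equality of the
  model is HOL equality. The schemas of Separation and Replacement range over first-order
  formulas only: admitting arbitrary HOL predicates would import choice from HOL into the model.
  All set-theoretic notions are first-order over the model. In particular the numbers \<open>n\<close> are
  elements of the \<open>\<omega>\<close> of the model, which may be nonstandard.
\<close>

datatype fm =
    Mem nat nat
  | Eq nat nat
  | Neg fm
  | Conj fm fm
  | Exists nat fm

locale set_structure =
  fixes mem :: "'m \<Rightarrow> 'm \<Rightarrow> bool" (infix "\<^bold>\<in>" 50)
begin

primrec sat :: "(nat \<Rightarrow> 'm) \<Rightarrow> fm \<Rightarrow> bool" where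
  "sat e (Mem i j) \<longleftrightarrow> e i \<^bold>\<in> e j"
| "sat e (Eq i j) \<longleftrightarrow> e i = e j"
| "sat e (Neg p) \<longleftrightarrow> \<not> sat e p"
| "sat e (Conj p q) \<longleftrightarrow> sat e p \<and> sat e q"
| "sat e (Exists i p) \<longleftrightarrow> (\<exists>a. sat (e(i := a)) p)"

definition subset :: "'m \<Rightarrow> 'm \<Rightarrow> bool" where
  "subset a b \<longleftrightarrow> (\<forall>x. x \<^bold>\<in> a \<longrightarrow> x \<^bold>\<in> b)"

definition is_empty :: "'m \<Rightarrow> bool" where
  "is_empty a \<longleftrightarrow> (\<forall>x. \<not> x \<^bold>\<in> a)"

definition is_one :: "'m \<Rightarrow> bool" where
  "is_one a \<longleftrightarrow> (\<forall>x. x \<^bold>\<in> a \<longleftrightarrow> is_empty x)"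

definition is_two :: "'m \<Rightarrow> bool" where
  "is_two a \<longleftrightarrow> (\<forall>x. x \<^bold>\<in> a \<longleftrightarrow> is_empty x \<or> is_one x)"

definition is_succ :: "'m \<Rightarrow> 'm \<Rightarrow> bool" where
  "is_succ s a \<longleftrightarrow> (\<forall>x. x \<^bold>\<in> s \<longleftrightarrow> x \<^bold>\<in> a \<or> x = a)"

definition is_inductive :: "'m \<Rightarrow> bool" where
  "is_inductive w \<longleftrightarrow>
     (\<exists>z. is_empty z \<and> z \<^bold>\<in> w) \<and> (\<forall>x. x \<^bold>\<in> w \<longrightarrow> (\<exists>s. is_succ s x \<and> s \<^bold>\<in> w))"

definition in_omega :: "'m \<Rightarrow> bool" where
  "in_omega n \<longleftrightarrow> (\<forall>w. is_inductive w \<longrightarrow> n \<^bold>\<in> w)"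

text \<open>The natural numbers start at 1.\<close>

definition in_N :: "'m \<Rightarrow> bool" where
  "in_N n \<longleftrightarrow> in_omega n \<and> \<not> is_empty n"

definition is_upair :: "'m \<Rightarrow> 'm \<Rightarrow> 'm \<Rightarrow> bool" where
  "is_upair p x y \<longleftrightarrow> (\<forall>z. z \<^bold>\<in> p \<longleftrightarrow> z = x \<or> z = y)"

text \<open>Kuratowski pairs: \<open>p = {{x}, {x, y}}\<close>.\<close>

definition is_opair :: "'m \<Rightarrow> 'm \<Rightarrow> 'm \<Rightarrow> bool" where
  "is_opair p x y \<longleftrightarrow> (\<exists>s t. is_upair s x x \<and> is_upair t x y \<and> is_upair p s t)"

definition maps_to :: "'m \<Rightarrow> 'm \<Rightarrow> 'm \<Rightarrow> bool" where
  "maps_to f x y \<longleftrightarrow> (\<exists>p. p \<^bold>\<in> f \<and> is_opair p x y)"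

definition is_function :: "'m \<Rightarrow> 'm \<Rightarrow> 'm \<Rightarrow> bool" where
  "is_function f a b \<longleftrightarrow>
     (\<forall>p. p \<^bold>\<in> f \<longrightarrow> (\<exists>x y. x \<^bold>\<in> a \<and> y \<^bold>\<in> b \<and> is_opair p x y)) \<and>
     (\<forall>x. x \<^bold>\<in> a \<longrightarrow> (\<exists>!y. maps_to f x y))"

definition is_bijection :: "'m \<Rightarrow> 'm \<Rightarrow> 'm \<Rightarrow> bool" where
  "is_bijection f a b \<longleftrightarrow> is_function f a b \<and>
     (\<forall>x x' y. maps_to f x y \<and> maps_to f x' y \<longrightarrow> x = x') \<and>
     (\<forall>y. y \<^bold>\<in> b \<longrightarrow> (\<exists>x. maps_to f x y))"

definition equipotent :: "'m \<Rightarrow> 'm \<Rightarrow> bool" where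
  "equipotent a b \<longleftrightarrow> (\<exists>f. is_bijection f a b)"

definition is_finite :: "'m \<Rightarrow> bool" where
  "is_finite a \<longleftrightarrow> (\<exists>n. in_omega n \<and> equipotent a n)"

definition is_complement :: "'m \<Rightarrow> 'm \<Rightarrow> 'm \<Rightarrow> bool" where
  "is_complement z x y \<longleftrightarrow> (\<forall>u. u \<^bold>\<in> z \<longleftrightarrow> u \<^bold>\<in> x \<and> \<not> u \<^bold>\<in> y)"

definition amorphous :: "'m \<Rightarrow> bool" where
  "amorphous x \<longleftrightarrow> \<not> is_finite x \<and>
     (\<forall>y. subset y x \<longrightarrow> is_finite y \<or> (\<exists>z. is_complement z x y \<and> is_finite z))"

text \<open>\<open>s = [x]\<^sup>n\<close>; an \<open>n\<close>-element set is one in bijection with \<open>n\<close>.\<close>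

definition is_n_subsets :: "'m \<Rightarrow> 'm \<Rightarrow> 'm \<Rightarrow> bool" where
  "is_n_subsets s x n \<longleftrightarrow> (\<forall>u. u \<^bold>\<in> s \<longleftrightarrow> subset u x \<and> equipotent u n)"

definition is_colouring :: "'m \<Rightarrow> 'm \<Rightarrow> 'm \<Rightarrow> bool" where
  "is_colouring c x n \<longleftrightarrow> (\<exists>s t. is_n_subsets s x n \<and> is_two t \<and> is_function c s t)"

definition constant_on :: "'m \<Rightarrow> 'm \<Rightarrow> bool" where
  "constant_on c s \<longleftrightarrow> (\<exists>v. \<forall>u. u \<^bold>\<in> s \<longrightarrow> maps_to c u v)"

definition R_finite :: "'m \<Rightarrow> 'm \<Rightarrow> bool" where
  "R_finite n x \<longleftrightarrow> (\<exists>c. is_colouring c x n \<and>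
     (\<forall>y. subset y x \<and> \<not> is_finite y \<longrightarrow> \<not> (\<exists>s. is_n_subsets s y n \<and> constant_on c s)))"

definition R_infinite :: "'m \<Rightarrow> 'm \<Rightarrow> bool" where
  "R_infinite n x \<longleftrightarrow> \<not> R_finite n x"

end

text \<open>
  In the two schemas, variable \<open>0\<close> (and \<open>1\<close> in Replacement) is the argument (and value) of the
  class given by \<open>p\<close>; the other values of \<open>e\<close> are its parameters.
\<close>

locale ZF = set_structure +
  assumes extensionality: "(\<forall>x. x \<^bold>\<in> a \<longleftrightarrow> x \<^bold>\<in> b) \<Longrightarrow> a = b"
    and foundation: "x \<^bold>\<in> a \<Longrightarrow> \<exists>y. y \<^bold>\<in> a \<and> \<not> (\<exists>z. z \<^bold>\<in> y \<and> z \<^bold>\<in> a)"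
    and pairing: "\<exists>p. \<forall>z. z \<^bold>\<in> p \<longleftrightarrow> z = x \<or> z = y"
    and union: "\<exists>u. \<forall>z. z \<^bold>\<in> u \<longleftrightarrow> (\<exists>y. z \<^bold>\<in> y \<and> y \<^bold>\<in> a)"
    and power_set: "\<exists>q. \<forall>z. z \<^bold>\<in> q \<longleftrightarrow> subset z a"
    and infinity: "\<exists>w. is_inductive w"
    and separation: "\<exists>b. \<forall>x. x \<^bold>\<in> b \<longleftrightarrow> x \<^bold>\<in> a \<and> sat (e(0 := x)) p"
    and replacement:
      "(\<forall>x y y'. x \<^bold>\<in> a \<and> sat (e(0 := x, 1 := y)) p \<and> sat (e(0 := x, 1 := y')) p \<longrightarrow> y = y') \<Longrightarrow>
       \<exists>b. \<forall>y. y \<^bold>\<in> b \<longleftrightarrow> (\<exists>x. x \<^bold>\<in> a \<and> sat (e(0 := x, 1 := y)) p)"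

end

theory Submission
  imports Defs
begin

text \<open>
  Write \<open>AE x. P x\<close> for ``all but finitely many \<open>x \<in> X\<close> satisfy \<open>P\<close>''. Amorphousness says that for a
  class \<open>P\<close> of the model either \<open>AE x. P x\<close> or \<open>AE x. \<not> P x\<close>, and that the infinite subsets of \<open>X\<close>
  are the cofinite ones. So \<open>X\<close> is \<open>R\<^sup>n\<close>-infinite iff every set \<open>C\<close>, read as the colouring ``\<open>u \<in> C\<close> or
  not'', is constant on the \<open>n\<close>-subsets that avoid some finite \<open>F\<close> (\<open>R_infinite_iff\<close>). The theorem
  follows from two facts about graphs, which show that everything is decided by \<open>n = 2\<close>.

  Let \<open>X\<close> be \<open>R\<^sup>2\<close>-finite, witnessed by a graph. Passing to the complement if need be, almost
  every vertex has finite degree. Colour an \<open>n\<close>-set, \<open>n \<ge> 2\<close>, by whether it contains an edge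
  between such vertices. Off a finite set there is still an edge, and it extends to an \<open>n\<close>-set;
  there is also an independent \<open>n\<close>-set, found greedily because the degrees are finite. Hence \<open>X\<close> is
  \<open>R\<^sup>n\<close>-finite (\<open>R_finite_of_R_finite_two\<close>).

  Let \<open>X\<close> be \<open>R\<^sup>2\<close>-infinite. Induction on \<open>n\<close> shows that \<open>X\<close> is \<open>R\<^sup>n\<close>-infinite. Given \<open>C\<close> on the
  \<open>(n+1)\<close>-sets, each \<open>x\<close> induces a colouring \<open>v \<mapsto> {x} \<union> v\<close> of the \<open>n\<close>-sets, which is constant off
  a finite set \<open>t\<close>. No \<open>t\<close> can be chosen for every \<open>x\<close> at once, but the union \<open>U\<^sub>x\<close> of all such \<open>t\<close> of least
  size is canonical, and it is still finite (\<open>finite_Union_least_transversals\<close>). The graph joining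
  \<open>x\<close> and \<open>y\<close> when \<open>y \<in> U\<^sub>x\<close> or \<open>x \<in> U\<^sub>y\<close> is complete or empty off a finite set. It is not complete:
  as \<open>U\<^sub>x\<close> is finite, that would give \<open>AE x. AE y. x \<in> U\<^sub>y\<close>, whereas \<open>AE x. x \<notin> U\<^sub>y\<close> for every \<open>y\<close>,
  and the quantifiers commute over an amorphous set (\<open>AE_commute\<close>). So it is empty, the colour of
  \<open>{x} \<union> v\<close> depends on \<open>x\<close> only, and almost all \<open>x\<close> give the same colour (\<open>homogeneous_succ\<close>).

  Commutation fails over \<open>\<omega>\<close>, for the relation \<open>x < y\<close>. It holds here because a function from an
  amorphous set to \<open>\<omega>\<close> is bounded almost everywhere (\<open>AE_bounded\<close>): otherwise parity would split \<open>X\<close>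
  into two infinite parts.

  All this takes place inside a model whose \<open>\<omega>\<close> may be nonstandard, so induction, separation and
  almost-everywhere dichotomy are available for first-order definable classes only. The predicate
  \<open>definable\<close> and the rules \<open>definable_intros\<close> make definability a matter of syntax-directed search.
\<close>

section \<open>Definable classes\<close>

primrec rename :: "(nat \<Rightarrow> nat) \<Rightarrow> fm \<Rightarrow> fm" where
  "rename r (Mem i j) = Mem (r i) (r j)"
| "rename r (Eq i j) = Eq (r i) (r j)"
| "rename r (Neg p) = Neg (rename r p)"
| "rename r (Conj p q) = Conj (rename r p) (rename r q)"
| "rename r (Exists i p) = Exists (r i) (rename r p)"

text \<open>
  Even positions hold the arguments of a relation and odd positions its parameters, so that both
  parts have infinitely many free places.
\<close>

definition interleave :: "(nat \<Rightarrow> 'a) \<Rightarrow> (nat \<Rightarrow> 'a) \<Rightarrow> nat \<Rightarrow> 'a" where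
  "interleave e c i = (if even i then e (i div 2) else c (i div 2))"

named_theorems definable_intros

context set_structure
begin

lemma sat_rename: "inj r \<Longrightarrow> sat e (rename r p) \<longleftrightarrow> sat (e \<circ> r) p"
proof (induction p arbitrary: e)
  case (Exists i p)
  have "(e(r i := a)) \<circ> r = (e \<circ> r)(i := a)" for a
    using Exists.prems by (auto simp: fun_eq_iff inj_eq)
  then show ?case using Exists.IH Exists.prems by (simp del: comp_apply fun_upd_apply)
qed (auto simp: comp_def)

text \<open>
  The relations on environments that are first-order definable with parameters. Position \<open>0\<close> is the
  innermost bound variable, so quantifying or fixing it shifts the other positions down. Defining
  the class by closure rules, rather than as an image of \<open>fm\<close>, makes substitution provable by
  induction without any question of variable capture.
\<close>

inductive definable :: "((nat \<Rightarrow> 'm) \<Rightarrow> bool) \<Rightarrow> bool" where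
  mem: "definable (\<lambda>e. e i \<^bold>\<in> e j)"
| eq: "definable (\<lambda>e. e i = e j)"
| neg: "definable P \<Longrightarrow> definable (\<lambda>e. \<not> P e)"
| conj: "definable P \<Longrightarrow> definable Q \<Longrightarrow> definable (\<lambda>e. P e \<and> Q e)"
| ex: "definable P \<Longrightarrow> definable (\<lambda>e. \<exists>a. P (case_nat a e))"
| param: "definable P \<Longrightarrow> definable (\<lambda>e. P (case_nat c e))"

text \<open>
  Quantifying or fixing position \<open>0\<close> shifts all arguments; the renaming \<open>up\<close> undoes that shift by moving
  argument \<open>0\<close> to the first parameter place and every parameter one place up. The renaming is
  injective, hence captures no variable.
\<close>

lemma definable_sat:
  assumes "definable P"
  obtains p c where "\<And>e. P e \<longleftrightarrow> sat (interleave e c) p"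
proof -
  define up :: "nat \<Rightarrow> nat" where
    "up i = (if i = 0 then 1 else if even i then i - 2 else i + 2)" for i
  have inj_up: "inj up"
    unfolding inj_def up_def by (auto; presburger)
  have up: "(interleave e (case_nat b c))(1 := a) \<circ> up = interleave (case_nat a e) c" for a b c and e :: "nat \<Rightarrow> 'm"
  proof
    fix i
    show "((interleave e (case_nat b c))(1 := a) \<circ> up) i = interleave (case_nat a e) c i"
    proof (cases "even i")
      case True
      then obtain k where "i = 2 * k" by blast
      then show ?thesis by (cases k) (auto simp: up_def interleave_def)
    next
      case False
      then obtain k where "i = 2 * k + 1" using oddE by blast
      then show ?thesis by (auto simp: up_def interleave_def)
    qed
  qed
  have "\<exists>p c. \<forall>e. P e \<longleftrightarrow> sat (interleave e c) p"
    using assms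
  proof induction
    case (mem i j)
    show ?case by (intro exI[of _ "Mem (2 * i) (2 * j)"]) (simp add: interleave_def)
  next
    case (eq i j)
    show ?case by (intro exI[of _ "Eq (2 * i) (2 * j)"]) (simp add: interleave_def)
  next
    case (neg P)
    then show ?case by (metis sat.simps(3))
  next
    case (conj P Q)
    then obtain p c q d where p: "\<And>e. P e \<longleftrightarrow> sat (interleave e c) p"
      and q: "\<And>e. Q e \<longleftrightarrow> sat (interleave e d) q" by blast
    \<comment> \<open>The parameters of the two conjuncts are themselves interleaved.\<close>
    define r s :: "nat \<Rightarrow> nat" where
      "r i = (if even i then i else 2 * i - 1)" and
      "s i = (if even i then i else 2 * i + 1)" for i
    have "inj r" "inj s" unfolding inj_def r_def s_def by (auto; presburger)+
    moreover have "interleave e (interleave c d) \<circ> r = interleave e c \<and>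
        interleave e (interleave c d) \<circ> s = interleave e d" for e
    proof -
      have "interleave e (interleave c d) (r i) = interleave e c i \<and>
          interleave e (interleave c d) (s i) = interleave e d i" for i
      proof (cases "even i")
        case True
        then show ?thesis by (simp add: interleave_def r_def s_def)
      next
        case False
        then obtain k where k: "i = 2 * k + 1" using oddE by blast
        have "r i = 2 * (2 * k) + 1" "s i = 2 * (2 * k + 1) + 1" by (simp_all add: k r_def s_def)
        then show ?thesis unfolding k by (simp add: interleave_def)
      qed
      then show ?thesis by (simp add: fun_eq_iff)
    qed
    ultimately have "P e \<and> Q e \<longleftrightarrow> sat (interleave e (interleave c d)) (Conj (rename r p) (rename s q))" for e
      by (simp add: p q sat_rename)
    then show ?case by blast
  next
    case (ex P)
    then obtain p c where p: "\<And>e. P e \<longleftrightarrow> sat (interleave e c) p" by blast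
    have "(\<exists>a. P (case_nat a e)) \<longleftrightarrow> sat (interleave e (case_nat undefined c)) (Exists 1 (rename up p))" for e
      using up by (simp add: p sat_rename inj_up)
    then show ?case by blast
  next
    case (param P a)
    then obtain p c where p: "\<And>e. P e \<longleftrightarrow> sat (interleave e c) p" by blast
    have "interleave e (case_nat a c) = (interleave e (case_nat a c))(1 := a)" for e
      by (auto simp: interleave_def)
    then have "P (case_nat a e) \<longleftrightarrow> sat (interleave e (case_nat a c)) (rename up p)" for e
      using up by (metis p sat_rename inj_up)
    then show ?case by blast
  qed
  then show ?thesis using that by blast
qed

text \<open>
  Any positions may be identified, permuted or fixed as parameters, even infinitely many of them:
  only finitely many occur, and the induction on the closure rules uses this implicitly.
\<close>

lemma definable_subst:
  assumes "definable P"
  shows "definable (\<lambda>e. P (\<lambda>i. case \<sigma> i of Inl j \<Rightarrow> e j | Inr c \<Rightarrow> c))"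
  using assms
proof (induction arbitrary: \<sigma>)
  case (mem i j)
  have "definable (\<lambda>e. c \<^bold>\<in> e k)" "definable (\<lambda>e. e k \<^bold>\<in> c)" for c :: 'm and k
    using definable.param[OF definable.mem[of 0 "Suc k"], of c]
      definable.param[OF definable.mem[of "Suc k" 0], of c] by simp_all
  moreover have "definable (\<lambda>e. c \<^bold>\<in> d)" for c d :: 'm
    using definable.param[OF definable.param[OF definable.mem[of 0 "Suc 0"]], of c d] by simp
  ultimately show ?case using definable.mem by (cases "\<sigma> i"; cases "\<sigma> j") auto
next
  case (eq i j)
  have "definable (\<lambda>e. c = e k)" "definable (\<lambda>e. e k = c)" for c :: 'm and k
    using definable.param[OF definable.eq[of 0 "Suc k"], of c]
      definable.param[OF definable.eq[of "Suc k" 0], of c] by simp_all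
  moreover have "definable (\<lambda>e. c = d)" for c d :: 'm
    using definable.param[OF definable.param[OF definable.eq[of 0 "Suc 0"]], of c d] by simp
  ultimately show ?case using definable.eq by (cases "\<sigma> i"; cases "\<sigma> j") auto
next
  case (neg P)
  then show ?case by (intro definable.neg)
next
  case (conj P Q)
  then show ?case by (intro definable.conj)
next
  case (ex P)
  let ?\<tau> = "case_nat (Inl 0) (\<lambda>i. case \<sigma> i of Inl j \<Rightarrow> Inl (Suc j) | Inr c \<Rightarrow> Inr c)"
  have "(\<lambda>i. case ?\<tau> i of Inl j \<Rightarrow> case_nat a e j | Inr c \<Rightarrow> c) =
      case_nat a (\<lambda>i. case \<sigma> i of Inl j \<Rightarrow> e j | Inr c \<Rightarrow> c)" for a e
    by (auto simp: fun_eq_iff split: nat.split sum.split)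
  then show ?case using definable.ex[OF ex.IH[of ?\<tau>]] by simp
next
  case (param P b)
  let ?\<tau> = "case_nat (Inl 0) (\<lambda>i. case \<sigma> i of Inl j \<Rightarrow> Inl (Suc j) | Inr c \<Rightarrow> Inr c)"
  have "(\<lambda>i. case ?\<tau> i of Inl j \<Rightarrow> case_nat a e j | Inr c \<Rightarrow> c) =
      case_nat a (\<lambda>i. case \<sigma> i of Inl j \<Rightarrow> e j | Inr c \<Rightarrow> c)" for a e
    by (auto simp: fun_eq_iff split: nat.split sum.split)
  then show ?case using definable.param[OF param.IH[of ?\<tau>], of b] by simp
qed

lemma definable_rename:
  assumes "definable P" shows "definable (\<lambda>e. P (\<lambda>i. e (r i)))"
  using definable_subst[OF assms, of "\<lambda>i. Inl (r i)"] by simp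

lemma definable_fix_params:
  assumes "definable (\<lambda>e. P (e 0) (\<lambda>i. e (Suc i)))"
  shows "definable (\<lambda>e. P (e 0) e')"
  using definable_subst[OF assms, of "case_nat (Inl 0) (\<lambda>i. Inr (e' i))"] by simp

text \<open>
  In this form the rules apply backwards to a goal written with ordinary binders: the bound
  variable becomes \<open>e 0\<close> and each free \<open>e i\<close> becomes \<open>e (Suc i)\<close> by beta reduction alone.
\<close>

lemma definable_ex [definable_intros]:
  assumes "definable (\<lambda>e. P (e 0) (\<lambda>i. e (Suc i)))"
  shows "definable (\<lambda>e. \<exists>a. P a e)"
  using definable.ex[OF assms] by simp

lemma definable_not [definable_intros]: "definable P \<Longrightarrow> definable (\<lambda>e. \<not> P e)"
  by (rule definable.neg)

lemma definable_and [definable_intros]: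
  "definable P \<Longrightarrow> definable Q \<Longrightarrow> definable (\<lambda>e. P e \<and> Q e)"
  by (rule definable.conj)

lemma definable_or [definable_intros]:
  assumes "definable P" "definable Q" shows "definable (\<lambda>e. P e \<or> Q e)"
proof -
  have "definable (\<lambda>e. \<not> (\<not> P e \<and> \<not> Q e))" by (intro definable_not definable_and assms)
  then show ?thesis by simp
qed

lemma definable_imp [definable_intros]:
  assumes "definable P" "definable Q" shows "definable (\<lambda>e. P e \<longrightarrow> Q e)"
proof -
  have "definable (\<lambda>e. \<not> P e \<or> Q e)" by (intro definable_not definable_or assms)
  then show ?thesis by (simp only: imp_conv_disj)
qed

lemma definable_iff [definable_intros]:
  assumes "definable P" "definable Q" shows "definable (\<lambda>e. P e \<longleftrightarrow> Q e)"
proof -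
  have "definable (\<lambda>e. (P e \<longrightarrow> Q e) \<and> (Q e \<longrightarrow> P e))" by (intro definable_and definable_imp assms)
  then show ?thesis by (simp only: iff_conv_conj_imp)
qed

lemma definable_all [definable_intros]:
  assumes "definable (\<lambda>e. P (e 0) (\<lambda>i. e (Suc i)))"
  shows "definable (\<lambda>e. \<forall>a. P a e)"
proof -
  have "definable (\<lambda>e. \<not> (\<exists>a. \<not> P a e))" by (intro definable_not definable_ex assms)
  then show ?thesis by simp
qed

text \<open>
  Terms need no syntax: with a definable graph as the only requirement, operations given by a description,
  such as \<open>Coll\<close> and \<open>card\<close> below, may occur inside formulas.
\<close>

definition definable_term :: "((nat \<Rightarrow> 'm) \<Rightarrow> 'm) \<Rightarrow> bool" where
  "definable_term t \<longleftrightarrow> definable (\<lambda>e. e 0 = t (\<lambda>i. e (Suc i)))"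

lemma definable_term_var [definable_intros]: "definable_term (\<lambda>e. e i)"
  unfolding definable_term_def by (rule definable.eq)

lemma definable_term_const [definable_intros]: "definable_term (\<lambda>e. c)"
proof -
  show ?thesis
    using definable.param[OF definable.eq[of "Suc 0" 0], of c] by (simp add: definable_term_def)
qed

lemma definable_term_rename:
  assumes "definable_term t" shows "definable_term (\<lambda>e. t (\<lambda>i. e (r i)))"
  using definable_rename[OF assms[unfolded definable_term_def], of "case_nat 0 (\<lambda>i. Suc (r i))"]
  by (simp add: definable_term_def)

text \<open>
  A relation given by its variables only may be applied to definable terms, since
  \<open>R (t e)\<close> says that some \<open>a\<close> with \<open>a = t e\<close> satisfies \<open>R\<close>.
\<close>

lemma definable_rel1:
  assumes "definable (\<lambda>e. R (e 0))" and "definable_term t"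
  shows "definable (\<lambda>e. R (t e))"
proof -
  have "definable (\<lambda>e. \<exists>a. a = t e \<and> R a)"
    by (intro definable_ex definable_and assms(1) assms(2)[unfolded definable_term_def])
  then show ?thesis by simp
qed

lemma definable_rel2:
  assumes R: "definable (\<lambda>e. R (e 0) (e (Suc 0)))" and t: "definable_term t" and u: "definable_term u"
  shows "definable (\<lambda>e. R (t e) (u e))"
proof -
  have "definable (\<lambda>e. \<exists>b. b = u e \<and> (\<exists>a. a = t e \<and> R a b))"
    by (intro definable_ex definable_and R u[unfolded definable_term_def]
        definable_term_rename[OF t, unfolded definable_term_def])
  then show ?thesis by simp
qed

lemma definable_rel3:
  assumes R: "definable (\<lambda>e. R (e 0) (e (Suc 0)) (e (Suc (Suc 0))))"
    and t: "definable_term t" and u: "definable_term u" and v: "definable_term v"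
  shows "definable (\<lambda>e. R (t e) (u e) (v e))"
proof -
  have "definable (\<lambda>e. \<exists>c. c = v e \<and> (\<exists>b. b = u e \<and> (\<exists>a. a = t e \<and> R a b c)))"
    by (intro definable_ex definable_and R v[unfolded definable_term_def]
        definable_term_rename[OF u, unfolded definable_term_def]
        definable_term_rename[OF t, unfolded definable_term_def])
  then show ?thesis by simp
qed

lemma definable_mem [definable_intros]:
  "definable_term t \<Longrightarrow> definable_term u \<Longrightarrow> definable (\<lambda>e. t e \<^bold>\<in> u e)"
  by (rule definable_rel2[where R = "(\<^bold>\<in>)"]) (rule definable.mem)

lemma definable_eq [definable_intros]:
  "definable_term t \<Longrightarrow> definable_term u \<Longrightarrow> definable (\<lambda>e. t e = u e)"
  by (rule definable_rel2[where R = "(=)"]) (rule definable.eq)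

lemma definable_term_fun1:
  assumes "definable (\<lambda>e. e 0 = f (e (Suc 0)))" and "definable_term t"
  shows "definable_term (\<lambda>e. f (t e))"
  unfolding definable_term_def
  by (rule definable_rel2[where R = "\<lambda>a b. a = f b"])
     (rule assms(1) definable_term_var definable_term_rename[OF assms(2)])+

lemma definable_term_fun2:
  assumes "definable (\<lambda>e. e 0 = f (e (Suc 0)) (e (Suc (Suc 0))))"
    and "definable_term t" and "definable_term u"
  shows "definable_term (\<lambda>e. f (t e) (u e))"
  unfolding definable_term_def
  by (rule definable_rel3[where R = "\<lambda>a b c. a = f b c"])
     (rule assms(1) definable_term_var definable_term_rename[OF assms(2)] definable_term_rename[OF assms(3)])+

lemma definable_is_empty [definable_intros]:
  "definable_term t \<Longrightarrow> definable (\<lambda>e. is_empty (t e))"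
  by (rule definable_rel1[where R = is_empty], unfold is_empty_def, intro definable_intros)

lemma definable_subset [definable_intros]:
  "definable_term t \<Longrightarrow> definable_term u \<Longrightarrow> definable (\<lambda>e. subset (t e) (u e))"
  by (rule definable_rel2[where R = subset], unfold subset_def, intro definable_intros)

lemma definable_is_succ [definable_intros]:
  "definable_term t \<Longrightarrow> definable_term u \<Longrightarrow> definable (\<lambda>e. is_succ (t e) (u e))"
  by (rule definable_rel2[where R = is_succ], unfold is_succ_def, intro definable_intros)

lemma definable_in_omega [definable_intros]:
  "definable_term t \<Longrightarrow> definable (\<lambda>e. in_omega (t e))"
  by (rule definable_rel1[where R = in_omega], unfold in_omega_def is_inductive_def, intro definable_intros)

lemma definable_is_opair [definable_intros]:
  "definable_term t \<Longrightarrow> definable_term u \<Longrightarrow> definable_term v \<Longrightarrow>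
    definable (\<lambda>e. is_opair (t e) (u e) (v e))"
  by (rule definable_rel3[where R = is_opair], unfold is_opair_def is_upair_def, intro definable_intros)

lemma definable_maps_to [definable_intros]:
  "definable_term t \<Longrightarrow> definable_term u \<Longrightarrow> definable_term v \<Longrightarrow>
    definable (\<lambda>e. maps_to (t e) (u e) (v e))"
  by (rule definable_rel3[where R = maps_to], unfold maps_to_def, intro definable_intros)

lemma definable_equipotent [definable_intros]:
  "definable_term t \<Longrightarrow> definable_term u \<Longrightarrow> definable (\<lambda>e. equipotent (t e) (u e))"
  by (rule definable_rel2[where R = equipotent],
      unfold equipotent_def is_bijection_def is_function_def Ex1_def, intro definable_intros)

lemma definable_is_finite [definable_intros]:
  "definable_term t \<Longrightarrow> definable (\<lambda>e. is_finite (t e))"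
  by (rule definable_rel1[where R = is_finite], unfold is_finite_def, intro definable_intros)

end

context ZF
begin

lemma definable_separation:
  assumes "definable (\<lambda>e. P (e 0))"
  shows "\<exists>b. \<forall>x. x \<^bold>\<in> b \<longleftrightarrow> x \<^bold>\<in> a \<and> P x"
proof -
  obtain p c where p: "\<And>e. P (e 0) \<longleftrightarrow> sat (interleave e c) p"
    using definable_sat[OF assms] by metis
  have "(interleave (\<lambda>_. a) c)(0 := x) = interleave (case_nat x (\<lambda>_. a)) c" for x
    by (auto simp: fun_eq_iff interleave_def split: nat.split)
  then have "sat ((interleave (\<lambda>_. a) c)(0 := x)) p \<longleftrightarrow> P x" for x
    using p[of "case_nat x (\<lambda>_. a)"] by simp
  then show ?thesis using separation[of a "interleave (\<lambda>_. a) c" p] by auto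
qed

lemma set_eqI: "(\<And>x. x \<^bold>\<in> a \<longleftrightarrow> x \<^bold>\<in> b) \<Longrightarrow> a = b"
  using extensionality by blast

text \<open>
  \<open>Coll a P\<close> is \<open>{x \<in> a. P x}\<close>; it is meaningful for definable \<open>P\<close> only.
\<close>

definition Coll :: "'a \<Rightarrow> ('a \<Rightarrow> bool) \<Rightarrow> 'a" where
  "Coll a P = (THE b. \<forall>x. x \<^bold>\<in> b \<longleftrightarrow> x \<^bold>\<in> a \<and> P x)"

lemma eq_Coll_iff:
  assumes "definable (\<lambda>e. P (e 0))"
  shows "b = Coll a P \<longleftrightarrow> (\<forall>x. x \<^bold>\<in> b \<longleftrightarrow> x \<^bold>\<in> a \<and> P x)"
proof -
  obtain c where c: "\<forall>x. x \<^bold>\<in> c \<longleftrightarrow> x \<^bold>\<in> a \<and> P x"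
    using definable_separation[OF assms] by blast
  then have "Coll a P = c" unfolding Coll_def
    by (intro the_equality) (auto intro: set_eqI)
  then show ?thesis using c by (auto intro: set_eqI)
qed

lemma mem_Coll:
  assumes "definable (\<lambda>e. P (e 0))"
  shows "x \<^bold>\<in> Coll a P \<longleftrightarrow> x \<^bold>\<in> a \<and> P x"
  using eq_Coll_iff[OF assms, of "Coll a P" a] by simp

lemma definable_term_Coll [definable_intros]:
  assumes "definable_term t" and P: "definable (\<lambda>e. P (e 0) (\<lambda>i. e (Suc i)))"
  shows "definable_term (\<lambda>e. Coll (t e) (\<lambda>x. P x e))"
proof -
  have eq: "b = Coll (t e) (\<lambda>x. P x e) \<longleftrightarrow> (\<forall>x. x \<^bold>\<in> b \<longleftrightarrow> x \<^bold>\<in> t e \<and> P x e)" for b e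
    by (rule eq_Coll_iff) (rule definable_fix_params[OF P])
  have "definable (\<lambda>e. P (e 0) (\<lambda>i. e (Suc (Suc i))))"
    using definable_rename[OF P, of "case_nat 0 (\<lambda>i. Suc (Suc i))"] by simp
  then show ?thesis unfolding definable_term_def eq
    by (intro definable_intros definable_term_rename[OF assms(1)])
qed

section \<open>Basic set operations\<close>

lemma subset_antisym: "subset a b \<Longrightarrow> subset b a \<Longrightarrow> a = b"
  by (auto simp: subset_def intro: set_eqI)

definition Emp :: 'a where "Emp = (THE z. is_empty z)"

lemma is_empty_iff: "is_empty z \<longleftrightarrow> z = Emp"
proof -
  obtain w where w: "is_empty w" using infinity is_inductive_def by blast
  then have "Emp = w" unfolding Emp_def
    by (intro the_equality) (auto simp: is_empty_def intro: set_eqI)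
  then show ?thesis using w by (auto simp: is_empty_def intro: set_eqI)
qed

lemma not_mem_Emp [simp]: "\<not> x \<^bold>\<in> Emp"
  using is_empty_iff is_empty_def by blast

lemma eq_Emp_iff: "a = Emp \<longleftrightarrow> (\<forall>x. \<not> x \<^bold>\<in> a)"
  using is_empty_iff is_empty_def by blast

definition Cup :: "'a \<Rightarrow> 'a \<Rightarrow> 'a" where
  "Cup a b = (THE u. \<forall>z. z \<^bold>\<in> u \<longleftrightarrow> z \<^bold>\<in> a \<or> z \<^bold>\<in> b)"

lemma mem_Cup [simp]: "z \<^bold>\<in> Cup a b \<longleftrightarrow> z \<^bold>\<in> a \<or> z \<^bold>\<in> b"
proof -
  obtain p where "\<forall>z. z \<^bold>\<in> p \<longleftrightarrow> z = a \<or> z = b" using pairing by blast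
  moreover obtain u where "\<forall>z. z \<^bold>\<in> u \<longleftrightarrow> (\<exists>y. z \<^bold>\<in> y \<and> y \<^bold>\<in> p)" using union by blast
  ultimately have u: "\<forall>z. z \<^bold>\<in> u \<longleftrightarrow> z \<^bold>\<in> a \<or> z \<^bold>\<in> b" by auto
  then have "Cup a b = u" unfolding Cup_def by (intro the_equality) (auto intro: set_eqI)
  then show ?thesis using u by blast
qed

lemma definable_term_Cup [definable_intros]:
  "definable_term t \<Longrightarrow> definable_term u \<Longrightarrow> definable_term (\<lambda>e. Cup (t e) (u e))"
proof (rule definable_term_fun2[where f = Cup])
  have "w = Cup a b \<longleftrightarrow> (\<forall>z. z \<^bold>\<in> w \<longleftrightarrow> z \<^bold>\<in> a \<or> z \<^bold>\<in> b)" for w a b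
    by (auto intro: set_eqI)
  then show "definable (\<lambda>e. e 0 = Cup (e (Suc 0)) (e (Suc (Suc 0))))"
    by (simp only:) (intro definable_intros)
qed

definition Insert :: "'a \<Rightarrow> 'a \<Rightarrow> 'a" where
  "Insert x a = (THE u. \<forall>z. z \<^bold>\<in> u \<longleftrightarrow> z = x \<or> z \<^bold>\<in> a)"

lemma mem_Insert [simp]: "z \<^bold>\<in> Insert x a \<longleftrightarrow> z = x \<or> z \<^bold>\<in> a"
proof -
  obtain p where "\<forall>z. z \<^bold>\<in> p \<longleftrightarrow> z = x \<or> z = x" using pairing by blast
  then have u: "\<forall>z. z \<^bold>\<in> Cup p a \<longleftrightarrow> z = x \<or> z \<^bold>\<in> a" by simp
  then have "Insert x a = Cup p a" unfolding Insert_def by (intro the_equality) (auto intro: set_eqI)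
  then show ?thesis using u by metis
qed

lemma definable_term_Insert [definable_intros]:
  "definable_term t \<Longrightarrow> definable_term u \<Longrightarrow> definable_term (\<lambda>e. Insert (t e) (u e))"
proof (rule definable_term_fun2[where f = Insert])
  have "w = Insert a b \<longleftrightarrow> (\<forall>z. z \<^bold>\<in> w \<longleftrightarrow> z = a \<or> z \<^bold>\<in> b)" for w a b
    by (auto intro: set_eqI)
  then show "definable (\<lambda>e. e 0 = Insert (e (Suc 0)) (e (Suc (Suc 0))))"
    by (simp only:) (intro definable_intros)
qed

lemma Insert_neq_Emp [simp]: "Insert x a \<noteq> Emp"
  using eq_Emp_iff mem_Insert by blast

definition Diff :: "'a \<Rightarrow> 'a \<Rightarrow> 'a" where
  "Diff a b = Coll a (\<lambda>x. \<not> x \<^bold>\<in> b)"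

lemma mem_Diff [simp]: "z \<^bold>\<in> Diff a b \<longleftrightarrow> z \<^bold>\<in> a \<and> \<not> z \<^bold>\<in> b"
  unfolding Diff_def by (rule mem_Coll) (intro definable_intros)

lemma definable_term_Diff [definable_intros]:
  "definable_term t \<Longrightarrow> definable_term u \<Longrightarrow> definable_term (\<lambda>e. Diff (t e) (u e))"
  by (rule definable_term_fun2[where f = Diff]) (unfold Diff_def, intro definable_intros)

definition Pow :: "'a \<Rightarrow> 'a" where
  "Pow a = (THE q. \<forall>z. z \<^bold>\<in> q \<longleftrightarrow> subset z a)"

lemma mem_Pow [simp]: "z \<^bold>\<in> Pow a \<longleftrightarrow> subset z a"
proof -
  obtain q where q: "\<forall>z. z \<^bold>\<in> q \<longleftrightarrow> subset z a" using power_set by blast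
  then have "Pow a = q" unfolding Pow_def by (intro the_equality) (auto intro: set_eqI)
  then show ?thesis using q by metis
qed

lemma not_mem_self [simp]: "\<not> x \<^bold>\<in> x"
  using foundation[of x "Insert x Emp"] by auto

lemma ex_opair: "\<exists>p. is_opair p x y"
proof -
  have "is_upair (Insert x Emp) x x" "is_upair (Insert x (Insert y Emp)) x y"
    by (auto simp: is_upair_def)
  moreover have "is_upair (Insert s (Insert t Emp)) s t" for s t
    by (auto simp: is_upair_def)
  ultimately show ?thesis unfolding is_opair_def by blast
qed

lemma opair_inject:
  assumes "is_opair p x y" and "is_opair p x' y'"
  shows "x = x' \<and> y = y'"
  using assms unfolding is_opair_def is_upair_def by metis

lemma opair_in_Pow_Pow:
  assumes "is_opair p x y" "x \<^bold>\<in> a" "y \<^bold>\<in> b"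
  shows "p \<^bold>\<in> Pow (Pow (Cup a b))"
  using assms by (auto simp: is_opair_def is_upair_def subset_def)

section \<open>The natural numbers of the model\<close>

definition omega :: 'a ("\<omega>") where
  "\<omega> = (THE w. \<forall>n. n \<^bold>\<in> w \<longleftrightarrow> in_omega n)"

lemma in_omega_iff: "in_omega n \<longleftrightarrow> n \<^bold>\<in> \<omega>"
proof -
  obtain w where w: "is_inductive w" using infinity by blast
  have m: "\<And>n. n \<^bold>\<in> Coll w in_omega \<longleftrightarrow> n \<^bold>\<in> w \<and> in_omega n"
    by (rule mem_Coll) (intro definable_intros)
  then have *: "\<forall>n. n \<^bold>\<in> Coll w in_omega \<longleftrightarrow> in_omega n"
    using w by (auto simp: in_omega_def)
  then have "\<omega> = Coll w in_omega" unfolding omega_def by (intro the_equality) (auto intro: set_eqI)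
  then show ?thesis using * by metis
qed

abbreviation succ :: "'a \<Rightarrow> 'a" where "succ n \<equiv> Insert n n"

lemma is_succ_iff: "is_succ s n \<longleftrightarrow> s = succ n"
  by (auto simp: is_succ_def intro: set_eqI)

lemma is_inductive_iff: "is_inductive w \<longleftrightarrow> Emp \<^bold>\<in> w \<and> (\<forall>x. x \<^bold>\<in> w \<longrightarrow> succ x \<^bold>\<in> w)"
  by (simp add: is_inductive_def is_succ_iff is_empty_iff)

lemma Emp_omega [simp]: "Emp \<^bold>\<in> \<omega>"
  by (simp add: in_omega_iff[symmetric] in_omega_def is_inductive_iff)

lemma succ_omega [simp]: "n \<^bold>\<in> \<omega> \<Longrightarrow> succ n \<^bold>\<in> \<omega>"
  by (simp add: in_omega_iff[symmetric] in_omega_def is_inductive_iff)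

lemma omega_induct [consumes 1, case_names definable zero succ]:
  assumes "n \<^bold>\<in> \<omega>" and P: "definable (\<lambda>e. P (e 0))"
    and "P Emp" and "\<And>k. k \<^bold>\<in> \<omega> \<Longrightarrow> P k \<Longrightarrow> P (succ k)"
  shows "P n"
proof -
  have "is_inductive (Coll \<omega> P)"
    using assms by (simp add: is_inductive_iff mem_Coll[OF P])
  then have "n \<^bold>\<in> Coll \<omega> P" using assms(1) by (simp add: in_omega_iff[symmetric] in_omega_def)
  then show ?thesis by (simp add: mem_Coll[OF P])
qed

lemma omega_cases:
  assumes "n \<^bold>\<in> \<omega>" obtains "n = Emp" | k where "k \<^bold>\<in> \<omega>" "n = succ k"
proof -
  have "n = Emp \<or> (\<exists>k. k \<^bold>\<in> \<omega> \<and> n = succ k)"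
    using assms by (induction rule: omega_induct) (intro definable_intros, auto)
  then show ?thesis using that by blast
qed

lemma omega_transitive: "n \<^bold>\<in> \<omega> \<Longrightarrow> k \<^bold>\<in> n \<Longrightarrow> k \<^bold>\<in> \<omega>"
proof (induction arbitrary: k rule: omega_induct)
  case definable
  show ?case by (intro definable_intros)
qed auto

lemma nat_transitive: "n \<^bold>\<in> \<omega> \<Longrightarrow> k \<^bold>\<in> n \<Longrightarrow> j \<^bold>\<in> k \<Longrightarrow> j \<^bold>\<in> n"
proof -
  assume "n \<^bold>\<in> \<omega>"
  then have "\<forall>k. k \<^bold>\<in> n \<longrightarrow> subset k n"
    by (induction rule: omega_induct) (intro definable_intros, auto simp: subset_def)
  then show "k \<^bold>\<in> n \<Longrightarrow> j \<^bold>\<in> k \<Longrightarrow> j \<^bold>\<in> n" by (auto simp: subset_def)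
qed

lemma succ_inject: "n \<^bold>\<in> \<omega> \<Longrightarrow> m \<^bold>\<in> \<omega> \<Longrightarrow> succ n = succ m \<Longrightarrow> n = m"
  by (metis mem_Insert nat_transitive not_mem_self)

lemma omega_linear:
  assumes "m \<^bold>\<in> \<omega>" "n \<^bold>\<in> \<omega>" shows "m \<^bold>\<in> n \<or> m = n \<or> n \<^bold>\<in> m"
proof -
  have zero: "n = Emp \<or> Emp \<^bold>\<in> n" if "n \<^bold>\<in> \<omega>" for n
    using that by (induction rule: omega_induct) (intro definable_intros, auto)
  have step: "succ m \<^bold>\<in> succ n" if "n \<^bold>\<in> \<omega>" "m \<^bold>\<in> n" for m n
  proof -
    have "\<forall>m. m \<^bold>\<in> n \<longrightarrow> succ m \<^bold>\<in> succ n"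
      using that(1) by (induction rule: omega_induct) (intro definable_intros, auto)
    then show ?thesis using that(2) by blast
  qed
  have "\<forall>n. n \<^bold>\<in> \<omega> \<longrightarrow> m \<^bold>\<in> n \<or> m = n \<or> n \<^bold>\<in> m"
    using assms(1)
  proof (induction rule: omega_induct)
    case definable
    show ?case by (intro definable_intros)
  next
    case zero
    show ?case using \<open>\<And>n. n \<^bold>\<in> \<omega> \<Longrightarrow> n = Emp \<or> Emp \<^bold>\<in> n\<close> by blast
  next
    case (succ k)
    then show ?case using step by (metis mem_Insert)
  qed
  then show ?thesis using assms(2) by blast
qed

lemma least_number:
  assumes P: "definable (\<lambda>e. P (e 0))" and "n \<^bold>\<in> \<omega>" "P n"
  obtains m where "m \<^bold>\<in> \<omega>" "P m" "\<And>k. k \<^bold>\<in> m \<Longrightarrow> \<not> P k"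
proof -
  have "n \<^bold>\<in> Coll \<omega> P" using assms by (simp add: mem_Coll[OF P])
  from foundation[OF this] show ?thesis
    using that omega_transitive by (auto simp: mem_Coll[OF P])
qed

section \<open>Equipotence\<close>

text \<open>
  Working with bijective relations, and turning them into sets of pairs only at the end,
  keeps Kuratowski pairs out of the arithmetic of cardinals.
\<close>

definition bijective :: "('a \<Rightarrow> 'a \<Rightarrow> bool) \<Rightarrow> 'a \<Rightarrow> 'a \<Rightarrow> bool" where
  "bijective R a b \<longleftrightarrow> (\<forall>x y. R x y \<longrightarrow> x \<^bold>\<in> a \<and> y \<^bold>\<in> b) \<and>
     (\<forall>x. x \<^bold>\<in> a \<longrightarrow> (\<exists>!y. R x y)) \<and> (\<forall>y. y \<^bold>\<in> b \<longrightarrow> (\<exists>!x. R x y))"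

lemma graph_of_relation:
  assumes R: "definable (\<lambda>e. R (e 0) (e (Suc 0)))"
    and sub: "\<And>x y. R x y \<Longrightarrow> x \<^bold>\<in> a \<and> y \<^bold>\<in> b"
  obtains f where "\<And>x y. maps_to f x y \<longleftrightarrow> R x y"
    "\<And>p. p \<^bold>\<in> f \<Longrightarrow> \<exists>x y. x \<^bold>\<in> a \<and> y \<^bold>\<in> b \<and> is_opair p x y"
proof -
  define f where "f = Coll (Pow (Pow (Cup a b))) (\<lambda>p. \<exists>x y. R x y \<and> is_opair p x y)"
  have f: "p \<^bold>\<in> f \<longleftrightarrow> p \<^bold>\<in> Pow (Pow (Cup a b)) \<and> (\<exists>x y. R x y \<and> is_opair p x y)" for p
    unfolding f_def by (rule mem_Coll) (intro definable_intros definable_rel2[where R = R, OF R])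
  show ?thesis
  proof
    show "maps_to f x y \<longleftrightarrow> R x y" for x y
      unfolding maps_to_def f using opair_inject ex_opair opair_in_Pow_Pow sub by metis
    show "\<exists>x y. x \<^bold>\<in> a \<and> y \<^bold>\<in> b \<and> is_opair p x y" if "p \<^bold>\<in> f" for p
      using that f sub by blast
  qed
qed

lemma equipotentI:
  assumes R: "definable (\<lambda>e. R (e 0) (e (Suc 0)))" and b: "bijective R a b"
  shows "equipotent a b"
proof -
  have sub: "\<And>x y. R x y \<Longrightarrow> x \<^bold>\<in> a \<and> y \<^bold>\<in> b" using b by (simp add: bijective_def)
  obtain f where f: "\<And>x y. maps_to f x y \<longleftrightarrow> R x y"
    "\<And>p. p \<^bold>\<in> f \<Longrightarrow> \<exists>x y. x \<^bold>\<in> a \<and> y \<^bold>\<in> b \<and> is_opair p x y"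
    using graph_of_relation[OF R, of a b] sub by metis
  have "is_bijection f a b"
    using b f(2) unfolding is_bijection_def is_function_def f(1) bijective_def by blast
  then show ?thesis unfolding equipotent_def by blast
qed

lemma equipotentE:
  assumes "equipotent a b"
  obtains R where "definable (\<lambda>e. R (e 0) (e (Suc 0)))" and "bijective R a b"
proof -
  obtain f where f: "is_bijection f a b" using assms equipotent_def by blast
  show ?thesis
  proof
    show "definable (\<lambda>e. maps_to f (e 0) (e (Suc 0)))" by (intro definable_intros)
    have 1: "x \<^bold>\<in> a \<and> y \<^bold>\<in> b" if "maps_to f x y" for x y
    proof -
      obtain p where p: "p \<^bold>\<in> f" "is_opair p x y" using \<open>maps_to f x y\<close> maps_to_def by blast
      then obtain x' y' where "x' \<^bold>\<in> a" "y' \<^bold>\<in> b" "is_opair p x' y'"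
        using f unfolding is_bijection_def is_function_def by blast
      then show ?thesis using p opair_inject by blast
    qed
    have 2: "\<exists>!y. maps_to f x y" if "x \<^bold>\<in> a" for x
      using f that unfolding is_bijection_def is_function_def by blast
    have 3: "\<exists>!x. maps_to f x y" if "y \<^bold>\<in> b" for y
      using f that unfolding is_bijection_def by blast
    show "bijective (maps_to f) a b"
      unfolding bijective_def using 1 2 3 by blast
  qed
qed

lemma equipotent_refl: "equipotent a a"
  by (rule equipotentI[where R = "\<lambda>x y. x = y \<and> x \<^bold>\<in> a"])
     (intro definable_intros, auto simp: bijective_def)

lemma equipotent_Emp_iff [simp]: "equipotent u Emp \<longleftrightarrow> u = Emp"
proof
  assume "equipotent u Emp"
  then obtain R where "bijective R u Emp" by (rule equipotentE)
  then have "\<not> x \<^bold>\<in> u" for x unfolding bijective_def by fastforce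
  then show "u = Emp" by (simp add: eq_Emp_iff)
qed (simp add: equipotent_refl)

lemma Emp_equipotent_iff [simp]: "equipotent Emp u \<longleftrightarrow> u = Emp"
proof
  assume "equipotent Emp u"
  then obtain R where "bijective R Emp u" by (rule equipotentE)
  then have "\<not> x \<^bold>\<in> u" for x unfolding bijective_def by fastforce
  then show "u = Emp" by (simp add: eq_Emp_iff)
qed (simp add: equipotent_refl)

lemma equipotent_Insert:
  assumes "equipotent a b" "\<not> x \<^bold>\<in> a" "\<not> y \<^bold>\<in> b"
  shows "equipotent (Insert x a) (Insert y b)"
proof -
  obtain R where R: "definable (\<lambda>e. R (e 0) (e (Suc 0)))" and b: "bijective R a b"
    using assms(1) by (rule equipotentE)
  show ?thesis
  proof (rule equipotentI)
    show "definable (\<lambda>e. e 0 = x \<and> e (Suc 0) = y \<or> R (e 0) (e (Suc 0)))"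
      by (intro definable_intros R)
    show "bijective (\<lambda>u v. u = x \<and> v = y \<or> R u v) (Insert x a) (Insert y b)"
      using b assms(2,3) unfolding bijective_def by auto
  qed
qed

text \<open>
  If \<open>x\<close> is not sent to \<open>y\<close>, redirect the element that is sent to \<open>y\<close> to the image of \<open>x\<close>.
\<close>

lemma equipotent_Diff:
  assumes "equipotent a (Insert y b)" "x \<^bold>\<in> a" "\<not> y \<^bold>\<in> b"
  shows "equipotent (Diff a (Insert x Emp)) b"
proof -
  obtain R where R: "definable (\<lambda>e. R (e 0) (e (Suc 0)))" and b: "bijective R a (Insert y b)"
    using assms(1) by (rule equipotentE)
  note [definable_intros] = definable_rel2[where R = R, OF R]
  let ?S = "\<lambda>u v. u \<noteq> x \<and> v \<noteq> y \<and> (R u v \<or> R u y \<and> R x v)"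
  have ex1: "R u v \<Longrightarrow> R u v' \<Longrightarrow> v = v'" "R u v \<Longrightarrow> R u' v \<Longrightarrow> u = u'"
    and dom: "R u v \<Longrightarrow> u \<^bold>\<in> a" "R u v \<Longrightarrow> v = y \<or> v \<^bold>\<in> b"
    and tot: "u \<^bold>\<in> a \<Longrightarrow> \<exists>v. R u v" "v = y \<or> v \<^bold>\<in> b \<Longrightarrow> \<exists>u. R u v" for u u' v v'
  proof -
    have b1: "\<And>x v. R x v \<Longrightarrow> x \<^bold>\<in> a \<and> v \<^bold>\<in> Insert y b"
      and b2: "\<And>x. x \<^bold>\<in> a \<Longrightarrow> \<exists>!v. R x v" and b3: "\<And>v. v \<^bold>\<in> Insert y b \<Longrightarrow> \<exists>!x. R x v"
      using b unfolding bijective_def by blast+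
    show "R u v \<Longrightarrow> R u v' \<Longrightarrow> v = v'" "R u v \<Longrightarrow> R u' v \<Longrightarrow> u = u'"
      "R u v \<Longrightarrow> u \<^bold>\<in> a" "u \<^bold>\<in> a \<Longrightarrow> \<exists>v. R u v" for u u' v v'
      using b1 b2 b3 by blast+
    show "R u v \<Longrightarrow> v = y \<or> v \<^bold>\<in> b" "v = y \<or> v \<^bold>\<in> b \<Longrightarrow> \<exists>u. R u v" for u v
      using b1[of u v] b3[of v] by auto
  qed
  show ?thesis
  proof (rule equipotentI)
    show "definable (\<lambda>e. ?S (e 0) (e (Suc 0)))" by (intro definable_intros)
    show "bijective ?S (Diff a (Insert x Emp)) b"
      unfolding bijective_def
    proof (intro conjI allI impI)
      fix u v
      show "?S u v \<Longrightarrow> u \<^bold>\<in> Diff a (Insert x Emp)" "?S u v \<Longrightarrow> v \<^bold>\<in> b"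
        using dom by auto
    next
      fix u assume "u \<^bold>\<in> Diff a (Insert x Emp)"
      then have u: "u \<^bold>\<in> a" "u \<noteq> x" by auto
      obtain v v' where v: "R u v" "R x v'" using tot(1)[OF u(1)] tot(1)[OF assms(2)] by blast
      show "\<exists>!v. ?S u v"
      proof (cases "v = y")
        case True
        have "v' \<noteq> y" using v True u(2) ex1(2) by blast
        then have "?S u v'" using u v True by auto
        moreover have "w = v'" if "?S u w" for w using that v True ex1(1) by blast
        ultimately show ?thesis by blast
      next
        case False
        then have "?S u v" using u v by auto
        then show ?thesis using u v ex1 False by metis
      qed
    next
      fix v assume "v \<^bold>\<in> b"
      then have v: "v \<^bold>\<in> b" "v \<noteq> y" using assms(3) by auto
      obtain u u' where u: "R u v" "R u' y" using tot(2)[of v] tot(2)[of y] v(1) by blast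
      show "\<exists>!u. ?S u v"
      proof (cases "u = x")
        case True
        have "u' \<noteq> x" using u True v(2) ex1(1) by blast
        then have "?S u' v" using u v True by auto
        moreover have "w = u'" if "?S w v" for w using that u True ex1(2) by blast
        ultimately show ?thesis by blast
      next
        case False
        then have "?S u v" using u v by auto
        then show ?thesis using u v ex1 False by metis
      qed
    qed
  qed
qed

lemma Insert_Diff: "x \<^bold>\<in> a \<Longrightarrow> Insert x (Diff a (Insert x Emp)) = a"
  by (auto intro!: set_eqI)

text \<open>
  Together with \<open>equipotent_Emp_iff\<close> this reduces statements about \<open>n\<close>-element sets to insertion of one
  element, after which bijections are no longer mentioned.
\<close>

lemma equipotent_succ_iff:
  "equipotent u (succ n) \<longleftrightarrow> (\<exists>x v. \<not> x \<^bold>\<in> v \<and> u = Insert x v \<and> equipotent v n)"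
proof
  assume u: "equipotent u (succ n)"
  then have "u \<noteq> Emp" by auto
  then obtain x where x: "x \<^bold>\<in> u" using eq_Emp_iff by blast
  then have "equipotent (Diff u (Insert x Emp)) n" using equipotent_Diff[OF u] by simp
  moreover have "u = Insert x (Diff u (Insert x Emp))" using Insert_Diff[OF x] by simp
  ultimately show "\<exists>x v. \<not> x \<^bold>\<in> v \<and> u = Insert x v \<and> equipotent v n"
    using mem_Diff mem_Insert by blast
qed (auto intro: equipotent_Insert)

lemma equipotent_unique:
  assumes "m \<^bold>\<in> \<omega>" "n \<^bold>\<in> \<omega>" "equipotent u m" "equipotent u n"
  shows "m = n"
proof -
  have "\<forall>u m. m \<^bold>\<in> \<omega> \<and> equipotent u m \<and> equipotent u n \<longrightarrow> m = n"
    using assms(2)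
  proof (induction rule: omega_induct)
    case definable
    show ?case by (intro definable_intros)
  next
    case zero
    show ?case by auto
  next
    case (succ k)
    show ?case
    proof (intro allI impI, elim conjE)
      fix u m assume m: "m \<^bold>\<in> \<omega>" "equipotent u m" and u: "equipotent u (succ k)"
      obtain x v where x: "\<not> x \<^bold>\<in> v" "u = Insert x v" "equipotent v k"
        using u equipotent_succ_iff by blast
      from m(1) show "m = succ k"
      proof (cases rule: omega_cases)
        case 1
        then show ?thesis using m(2) x(2) by simp
      next
        case (2 j)
        have "Diff u (Insert x Emp) = v" using x by (auto intro!: set_eqI)
        then have "equipotent v j" using equipotent_Diff[of u j j x] m 2 x by auto
        then show ?thesis using succ x(3) 2 by blast
      qed
    qed
  qed
  then show ?thesis using assms by blast
qed

lemma card_subset: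
  assumes "m \<^bold>\<in> \<omega>" "equipotent t m" "subset s t"
  obtains k where "k \<^bold>\<in> \<omega>" "equipotent s k" "k \<^bold>\<in> m \<or> s = t"
proof -
  have "\<forall>t s. equipotent t m \<and> subset s t \<longrightarrow>
      (\<exists>k. k \<^bold>\<in> \<omega> \<and> equipotent s k \<and> (k \<^bold>\<in> m \<or> s = t))"
    using assms(1)
  proof (induction rule: omega_induct)
    case definable
    show ?case by (intro definable_intros)
  next
    case zero
    have "subset s Emp \<Longrightarrow> s = Emp" for s by (simp add: subset_def eq_Emp_iff)
    then show ?case by (auto intro: exI[of _ Emp])
  next
    case (succ n)
    show ?case
    proof (intro allI impI, elim conjE)
      fix t s assume t: "equipotent t (succ n)" and s: "subset s t"
      show "\<exists>k. k \<^bold>\<in> \<omega> \<and> equipotent s k \<and> (k \<^bold>\<in> succ n \<or> s = t)"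
      proof (cases "s = t")
        case True
        then show ?thesis using t succ.hyps by (auto intro: exI[of _ "succ n"])
      next
        case False
        then obtain x where x: "x \<^bold>\<in> t" "\<not> x \<^bold>\<in> s"
          using s subset_antisym unfolding subset_def by blast
        then have "subset s (Diff t (Insert x Emp))" using s by (auto simp: subset_def)
        then obtain k where "k \<^bold>\<in> \<omega>" "equipotent s k" "k \<^bold>\<in> n \<or> s = Diff t (Insert x Emp)"
          using succ equipotent_Diff[OF t x(1)] by (metis not_mem_self)
        moreover have "k = n" if "s = Diff t (Insert x Emp)"
          using that calculation succ(1) equipotent_Diff[OF t x(1)] equipotent_unique by simp
        ultimately show ?thesis by auto
      qed
    qed
  qed
  then show ?thesis using assms that by blast
qed

section \<open>Finite sets\<close>

lemma is_finite_iff: "is_finite a \<longleftrightarrow> (\<exists>n. n \<^bold>\<in> \<omega> \<and> equipotent a n)"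
  by (simp add: is_finite_def in_omega_iff)

lemma finite_Emp [simp]: "is_finite Emp"
  unfolding is_finite_iff by (auto intro: exI[of _ Emp])

lemma finite_nat: "n \<^bold>\<in> \<omega> \<Longrightarrow> is_finite n"
  unfolding is_finite_iff using equipotent_refl by blast

lemma finite_Insert: "is_finite a \<Longrightarrow> is_finite (Insert x a)"
proof (cases "x \<^bold>\<in> a")
  case True
  then have "Insert x a = a" by (auto intro!: set_eqI)
  then show "is_finite a \<Longrightarrow> ?thesis" by simp
next
  case False
  then show "is_finite a \<Longrightarrow> ?thesis"
    unfolding is_finite_iff using equipotent_Insert not_mem_self succ_omega by meson
qed

lemma finite_induct [consumes 1, case_names definable empty insert]:
  assumes "is_finite a" and P: "definable (\<lambda>e. P (e 0))" and "P Emp"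
    and "\<And>x a. is_finite a \<Longrightarrow> \<not> x \<^bold>\<in> a \<Longrightarrow> P a \<Longrightarrow> P (Insert x a)"
  shows "P a"
proof -
  have "\<forall>a. equipotent a n \<longrightarrow> P a" if "n \<^bold>\<in> \<omega>" for n
    using that
  proof (induction rule: omega_induct)
    case definable
    show ?case by (intro definable_intros definable_rel1[where R = P, OF P])
  next
    case zero
    then show ?case using assms by simp
  next
    case (succ k)
    then show ?case using assms(4) equipotent_succ_iff is_finite_iff by metis
  qed
  then show ?thesis using assms(1) is_finite_iff by blast
qed

lemma finite_subset: "is_finite t \<Longrightarrow> subset s t \<Longrightarrow> is_finite s"
  unfolding is_finite_iff by (metis card_subset)

lemma finite_Cup: 
  assumes "is_finite a" "is_finite b" shows "is_finite (Cup a b)"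
  using assms(1)
proof (induction rule: finite_induct)
  case definable
  show ?case by (intro definable_intros)
next
  case empty
  have "Cup Emp b = b" by (auto intro: set_eqI)
  then show ?case using assms by simp
next
  case (insert x a)
  have "Cup (Insert x a) b = Insert x (Cup a b)" by (auto intro: set_eqI)
  then show ?case using insert finite_Insert by simp
qed

lemma finite_UN:
  assumes R: "definable (\<lambda>e. R (e 0) (e (Suc 0)))" and "is_finite s"
    and "\<And>i. i \<^bold>\<in> s \<Longrightarrow> is_finite (Coll a (R i))"
  shows "is_finite (Coll a (\<lambda>x. \<exists>i. i \<^bold>\<in> s \<and> R i x))"
proof -
  note [definable_intros] = definable_rel2[where R = R, OF R]
  have mem: "x \<^bold>\<in> Coll a (\<lambda>x. \<exists>i. i \<^bold>\<in> s \<and> R i x) \<longleftrightarrow> x \<^bold>\<in> a \<and> (\<exists>i. i \<^bold>\<in> s \<and> R i x)" for x s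
    by (rule mem_Coll) (intro definable_intros)
  have mem': "x \<^bold>\<in> Coll a (R i) \<longleftrightarrow> x \<^bold>\<in> a \<and> R i x" for x i
    by (rule mem_Coll) (intro definable_intros)
  have "(\<forall>i. i \<^bold>\<in> s \<longrightarrow> is_finite (Coll a (R i))) \<longrightarrow> is_finite (Coll a (\<lambda>x. \<exists>i. i \<^bold>\<in> s \<and> R i x))"
    using assms(2)
  proof (induction rule: finite_induct)
    case definable
    show ?case by (intro definable_intros)
  next
    case empty
    have "Coll a (\<lambda>x. \<exists>i. i \<^bold>\<in> Emp \<and> R i x) = Emp" by (simp only: eq_Emp_iff mem) simp
    then show ?case by simp
  next
    case (insert j s)
    have "Coll a (\<lambda>x. \<exists>i. i \<^bold>\<in> Insert j s \<and> R i x) =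
        Cup (Coll a (R j)) (Coll a (\<lambda>x. \<exists>i. i \<^bold>\<in> s \<and> R i x))"
      by (rule set_eqI, unfold mem mem' mem_Cup) auto
    then show ?case using insert finite_Cup by simp
  qed
  then show ?thesis using assms(3) by blast
qed

section \<open>Cardinals of finite sets\<close>

definition card :: "'a \<Rightarrow> 'a" where
  "card u = (if is_finite u then THE n. n \<^bold>\<in> \<omega> \<and> equipotent u n else Emp)"

lemma card_eqI: "n \<^bold>\<in> \<omega> \<Longrightarrow> equipotent u n \<Longrightarrow> card u = n"
  unfolding card_def using is_finite_iff equipotent_unique by (auto intro!: the_equality)

lemma equipotent_card: "is_finite u \<Longrightarrow> equipotent u (card u)"
  using card_eqI is_finite_iff by auto

lemma card_omega [simp]: "card u \<^bold>\<in> \<omega>"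
proof (cases "is_finite u")
  case True
  then show ?thesis using card_eqI is_finite_iff by metis
qed (simp add: card_def)

lemma card_Insert: "is_finite a \<Longrightarrow> \<not> x \<^bold>\<in> a \<Longrightarrow> card (Insert x a) = succ (card a)"
  by (rule card_eqI) (auto intro: equipotent_Insert equipotent_card)

lemma definable_term_card [definable_intros]:
  "definable_term t \<Longrightarrow> definable_term (\<lambda>e. card (t e))"
proof (rule definable_term_fun1[where f = card])
  have "n = card a \<longleftrightarrow> n \<^bold>\<in> \<omega> \<and> (is_finite a \<longrightarrow> equipotent a n) \<and> (\<not> is_finite a \<longrightarrow> n = Emp)" for n a
  proof (cases "is_finite a")
    case True
    then show ?thesis using card_eqI equipotent_card card_omega by metis
  qed (auto simp: card_def)
  then show "definable (\<lambda>e. e 0 = card (e (Suc 0)))"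
    by (simp only:) (intro definable_intros)
qed

lemma card_psubset:
  assumes "is_finite t" "subset s t" "s \<noteq> t"
  shows "card s \<^bold>\<in> card t"
  using card_subset[OF card_omega equipotent_card[OF assms(1)] assms(2)] card_eqI assms(3) by metis

section \<open>Colourings as sets\<close>

lemma is_one_iff: "is_one a \<longleftrightarrow> a = succ Emp"
  by (auto simp: is_one_def is_empty_iff intro: set_eqI)

lemma is_two_iff: "is_two t \<longleftrightarrow> t = succ (succ Emp)"
  by (auto simp: is_two_def is_empty_iff is_one_iff intro: set_eqI)

lemma ex_n_subsets: "\<exists>s. is_n_subsets s a n"
proof -
  have "x \<^bold>\<in> Coll (Pow a) (\<lambda>u. equipotent u n) \<longleftrightarrow> x \<^bold>\<in> Pow a \<and> equipotent x n" for x
    by (rule mem_Coll) (intro definable_intros)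
  then have "is_n_subsets (Coll (Pow a) (\<lambda>u. equipotent u n)) a n"
    by (simp add: is_n_subsets_def)
  then show ?thesis by blast
qed

text \<open>
  A colouring amounts to its colour class \<open>C\<close>, so that functions can be forgotten from here on.
\<close>

lemma R_finite_iff:
  "R_finite n a \<longleftrightarrow> (\<exists>C. \<forall>y. subset y a \<and> \<not> is_finite y \<longrightarrow>
     (\<exists>u. subset u y \<and> equipotent u n \<and> u \<^bold>\<in> C) \<and> (\<exists>u. subset u y \<and> equipotent u n \<and> \<not> u \<^bold>\<in> C))"
  (is "_ \<longleftrightarrow> ?R")
proof
  assume "R_finite n a"
  then obtain c s t where s: "is_n_subsets s a n" and t: "is_two t" and c: "is_function c s t"
    and hom: "\<And>y s. subset y a \<Longrightarrow> \<not> is_finite y \<Longrightarrow> is_n_subsets s y n \<Longrightarrow> \<not> constant_on c s"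
    unfolding R_finite_def is_colouring_def by blast
  define C where "C = Coll s (\<lambda>u. maps_to c u (succ Emp))"
  have C: "u \<^bold>\<in> C \<longleftrightarrow> u \<^bold>\<in> s \<and> maps_to c u (succ Emp)" for u
    unfolding C_def by (rule mem_Coll) (intro definable_intros)
  have two: "maps_to c u (succ Emp) \<or> maps_to c u Emp" if "u \<^bold>\<in> s" for u
  proof -
    obtain v where v: "maps_to c u v" using c \<open>u \<^bold>\<in> s\<close> unfolding is_function_def by blast
    then obtain p where p: "p \<^bold>\<in> c" "is_opair p u v" using maps_to_def by blast
    then obtain x y where "y \<^bold>\<in> t" "is_opair p x y" using c unfolding is_function_def by blast
    then have "v \<^bold>\<in> t" using p opair_inject by blast
    then show ?thesis using v t by (auto simp: is_two_iff)
  qed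
  have "(\<exists>u. subset u y \<and> equipotent u n \<and> u \<^bold>\<in> C) \<and> (\<exists>u. subset u y \<and> equipotent u n \<and> \<not> u \<^bold>\<in> C)"
    if y: "subset y a" "\<not> is_finite y" for y
  proof -
    obtain s' where s': "is_n_subsets s' y n" using ex_n_subsets by blast
    then have sub: "u \<^bold>\<in> s" if "u \<^bold>\<in> s'" for u
      using that s y(1) by (auto simp: is_n_subsets_def subset_def)
    have "\<not> (\<forall>u. u \<^bold>\<in> s' \<longrightarrow> maps_to c u (succ Emp))" "\<not> (\<forall>u. u \<^bold>\<in> s' \<longrightarrow> maps_to c u Emp)"
      using hom[OF y s'] unfolding constant_on_def by blast+
    then obtain u u' where "u \<^bold>\<in> s'" "\<not> maps_to c u (succ Emp)" "u' \<^bold>\<in> s'" "\<not> maps_to c u' Emp"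
      by blast
    then show ?thesis using C two sub s' unfolding is_n_subsets_def by blast
  qed
  then show ?R by blast
next
  assume ?R
  then obtain C where C: "\<And>y. subset y a \<Longrightarrow> \<not> is_finite y \<Longrightarrow>
      (\<exists>u. subset u y \<and> equipotent u n \<and> u \<^bold>\<in> C) \<and> (\<exists>u. subset u y \<and> equipotent u n \<and> \<not> u \<^bold>\<in> C)"
    by blast
  obtain s where s: "is_n_subsets s a n" using ex_n_subsets by blast
  let ?t = "succ (succ Emp)"
  let ?R = "\<lambda>u v. u \<^bold>\<in> s \<and> (u \<^bold>\<in> C \<and> v = succ Emp \<or> \<not> u \<^bold>\<in> C \<and> v = Emp)"
  have "definable (\<lambda>e. ?R (e 0) (e (Suc 0)))" by (intro definable_intros)
  then obtain c where c: "\<And>u v. maps_to c u v \<longleftrightarrow> ?R u v"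
    "\<And>p. p \<^bold>\<in> c \<Longrightarrow> \<exists>u v. u \<^bold>\<in> s \<and> v \<^bold>\<in> ?t \<and> is_opair p u v"
    using graph_of_relation[of ?R s ?t] by auto
  have "is_function c s ?t" unfolding is_function_def c(1) using c(2) by blast
  then have "is_colouring c a n"
    unfolding is_colouring_def is_two_iff using s by blast
  moreover have "\<not> constant_on c s'" if y: "subset y a" "\<not> is_finite y" "is_n_subsets s' y n" for y s'
  proof
    assume "constant_on c s'"
    then obtain v where v: "\<And>u. u \<^bold>\<in> s' \<Longrightarrow> ?R u v" unfolding constant_on_def c(1) by blast
    obtain u u' where "u \<^bold>\<in> s'" "u \<^bold>\<in> C" "u' \<^bold>\<in> s'" "\<not> u' \<^bold>\<in> C"
      using C[OF y(1,2)] y(3) unfolding is_n_subsets_def by blast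
    then show False using v[of u] v[of u'] by auto
  qed
  ultimately show "R_finite n a" unfolding R_finite_def by blast
qed

section \<open>Parity\<close>

text \<open>
  Parity without arithmetic or recursion: a set that contains \<open>0\<close> and alternates up to \<open>n\<close> exists, and
  any two agree at \<open>n\<close>.
\<close>

definition alternating :: "'a \<Rightarrow> 'a \<Rightarrow> bool" where
  "alternating s n \<longleftrightarrow> Emp \<^bold>\<in> s \<and> (\<forall>k. k \<^bold>\<in> n \<longrightarrow> (succ k \<^bold>\<in> s \<longleftrightarrow> \<not> k \<^bold>\<in> s))"

definition is_even :: "'a \<Rightarrow> bool" where
  "is_even n \<longleftrightarrow> (\<exists>s. alternating s n \<and> n \<^bold>\<in> s)"

lemma definable_is_even [definable_intros]:
  "definable_term t \<Longrightarrow> definable (\<lambda>e. is_even (t e))"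
  by (rule definable_rel1[where R = is_even], unfold is_even_def alternating_def, intro definable_intros)

lemma alternating_succD: "alternating s (succ n) \<Longrightarrow> alternating s n"
  by (auto simp: alternating_def)

lemma ex_alternating: "n \<^bold>\<in> \<omega> \<Longrightarrow> \<exists>s. alternating s n"
proof (induction rule: omega_induct)
  case definable
  show ?case unfolding alternating_def by (intro definable_intros)
next
  case zero
  have "alternating (Insert Emp Emp) Emp" by (simp add: alternating_def)
  then show ?case by blast
next
  case (succ n)
  then obtain s where s: "alternating s n" by blast
  define s' where "s' = (if n \<^bold>\<in> s then Diff s (Insert (succ n) Emp) else Insert (succ n) s)"
  have "n \<noteq> succ n" "Emp \<noteq> succ n" using not_mem_self[of n] mem_Insert[of n n n] Insert_neq_Emp by metis+
  have 1: "succ n \<^bold>\<in> s' \<longleftrightarrow> \<not> n \<^bold>\<in> s" by (simp add: s'_def)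
  have 2: "x \<^bold>\<in> s' \<longleftrightarrow> x \<^bold>\<in> s" if "x \<noteq> succ n" for x using that by (simp add: s'_def)
  have "succ k \<^bold>\<in> s' \<longleftrightarrow> \<not> k \<^bold>\<in> s'" if k: "k \<^bold>\<in> n" for k
  proof -
    have "k \<^bold>\<in> \<omega>" using k succ omega_transitive by blast
    then have "succ k \<noteq> succ n" using succ_inject succ k not_mem_self by metis
    moreover have "k \<noteq> succ n" using k succ nat_transitive[of n k n] by auto
    ultimately show ?thesis using 2 s k by (simp add: alternating_def)
  qed
  moreover have "succ n \<^bold>\<in> s' \<longleftrightarrow> \<not> n \<^bold>\<in> s'" using 1 2 \<open>n \<noteq> succ n\<close> by blast
  moreover have "Emp \<^bold>\<in> s'" using 2 \<open>Emp \<noteq> succ n\<close> s by (simp add: alternating_def)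
  ultimately have "alternating s' (succ n)" by (auto simp: alternating_def)
  then show ?case by blast
qed

lemma alternating_unique:
  assumes "n \<^bold>\<in> \<omega>" "alternating s n" "alternating s' n"
  shows "n \<^bold>\<in> s \<longleftrightarrow> n \<^bold>\<in> s'"
proof -
  have "\<forall>s s'. alternating s n \<and> alternating s' n \<longrightarrow> (n \<^bold>\<in> s \<longleftrightarrow> n \<^bold>\<in> s')"
    using assms(1)
  proof (induction rule: omega_induct)
    case definable
    show ?case unfolding alternating_def by (intro definable_intros)
  next
    case zero
    show ?case by (simp add: alternating_def)
  next
    case (succ k)
    have "succ k \<^bold>\<in> s \<longleftrightarrow> \<not> k \<^bold>\<in> s" if "alternating s (succ k)" for s
      using that by (simp add: alternating_def)
    then show ?case using succ.IH alternating_succD by blast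
  qed
  then show ?thesis using assms by blast
qed

lemma is_even_succ: 
  assumes "n \<^bold>\<in> \<omega>" shows "is_even (succ n) \<longleftrightarrow> \<not> is_even n"
proof -
  obtain s where s: "alternating s (succ n)" using ex_alternating assms succ_omega by blast
  then have "is_even (succ n) \<longleftrightarrow> succ n \<^bold>\<in> s"
    using alternating_unique[OF succ_omega[OF assms]] unfolding is_even_def by blast
  moreover have "is_even n \<longleftrightarrow> n \<^bold>\<in> s"
    using alternating_unique[OF assms] alternating_succD[OF s] unfolding is_even_def by blast
  moreover have "succ n \<^bold>\<in> s \<longleftrightarrow> \<not> n \<^bold>\<in> s" using s by (simp add: alternating_def)
  ultimately show ?thesis by blast
qed

end

section \<open>Almost all elements of an amorphous set\<close>

locale amorphous_set = ZF +
  fixes X :: 'a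
  assumes amorphous_X: "amorphous X"
begin

lemma infinite_X: "\<not> is_finite X"
  using amorphous_X amorphous_def by blast

definition AE :: "('a \<Rightarrow> bool) \<Rightarrow> bool" (binder "AE " 10) where
  "(AE x. P x) \<longleftrightarrow> (\<exists>F. is_finite F \<and> (\<forall>x. x \<^bold>\<in> X \<and> \<not> x \<^bold>\<in> F \<longrightarrow> P x))"

lemma definable_AE [definable_intros]:
  assumes P: "definable (\<lambda>e. P (e 0) (\<lambda>i. e (Suc i)))"
  shows "definable (\<lambda>e. AE x. P x e)"
proof -
  have "definable (\<lambda>e. P (e 0) (\<lambda>i. e (Suc (Suc i))))"
    using definable_rename[OF P, of "case_nat 0 (\<lambda>i. Suc (Suc i))"] by simp
  then show ?thesis unfolding AE_def by (intro definable_intros)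
qed

lemma AE_I: "(\<And>x. x \<^bold>\<in> X \<Longrightarrow> P x) \<Longrightarrow> AE x. P x"
  unfolding AE_def using finite_Emp by blast

lemma AE_mp:
  assumes "AE x. P x" "\<And>x. x \<^bold>\<in> X \<Longrightarrow> P x \<Longrightarrow> Q x" shows "AE x. Q x"
  using assms unfolding AE_def by blast

lemma AE_conj:
  assumes "AE x. P x" "AE x. Q x" shows "AE x. P x \<and> Q x"
proof -
  obtain F G where "is_finite F" "is_finite G"
    "\<And>x. x \<^bold>\<in> X \<Longrightarrow> \<not> x \<^bold>\<in> F \<Longrightarrow> P x" "\<And>x. x \<^bold>\<in> X \<Longrightarrow> \<not> x \<^bold>\<in> G \<Longrightarrow> Q x"
    using assms unfolding AE_def by blast
  then show ?thesis unfolding AE_def using finite_Cup by (intro exI[of _ "Cup F G"]) auto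
qed

lemma AE_ex:
  assumes "AE x. P x" obtains x where "x \<^bold>\<in> X" "P x"
proof -
  obtain F where F: "is_finite F" "\<And>x. x \<^bold>\<in> X \<Longrightarrow> \<not> x \<^bold>\<in> F \<Longrightarrow> P x"
    using assms unfolding AE_def by blast
  have "\<not> subset X F" using F(1) finite_subset infinite_X by blast
  then show ?thesis using F that unfolding subset_def by blast
qed

lemma AE_not_mem: "is_finite F \<Longrightarrow> AE x. \<not> x \<^bold>\<in> F"
  unfolding AE_def by blast

lemma AE_cases:
  assumes P: "definable (\<lambda>e. P (e 0))"
  shows "(AE x. P x) \<or> (AE x. \<not> P x)"
proof -
  have "subset (Coll X P) X" by (simp add: subset_def mem_Coll[OF P])
  then consider "is_finite (Coll X P)" | z where "is_complement z X (Coll X P)" "is_finite z"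
    using amorphous_X unfolding amorphous_def by blast
  then show ?thesis
  proof cases
    case 1
    then have "AE x. \<not> P x" unfolding AE_def by (intro exI[of _ "Coll X P"]) (simp add: mem_Coll[OF P])
    then show ?thesis by blast
  next
    case 2
    then have "AE x. P x" unfolding AE_def is_complement_def
      by (intro exI[of _ z]) (auto simp add: mem_Coll[OF P])
    then show ?thesis by blast
  qed
qed

lemma finite_of_AE_not:
  assumes P: "definable (\<lambda>e. P (e 0))" and "AE x. \<not> P x"
  shows "is_finite (Coll X P)"
proof -
  obtain F where F: "is_finite F" "\<And>x. x \<^bold>\<in> X \<Longrightarrow> \<not> x \<^bold>\<in> F \<Longrightarrow> \<not> P x"
    using assms(2) unfolding AE_def by blast
  then have "subset (Coll X P) F" by (auto simp: subset_def mem_Coll[OF P])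
  then show ?thesis using F(1) finite_subset by blast
qed

lemma AE_finite_all:
  assumes R: "definable (\<lambda>e. R (e 0) (e (Suc 0)))" and "is_finite I"
    and "\<And>i. i \<^bold>\<in> I \<Longrightarrow> AE x. R i x"
  shows "AE x. \<forall>i. i \<^bold>\<in> I \<longrightarrow> R i x"
proof -
  note [definable_intros] = definable_rel2[where R = R, OF R]
  have "(\<forall>i. i \<^bold>\<in> I \<longrightarrow> (AE x. R i x)) \<longrightarrow> (AE x. \<forall>i. i \<^bold>\<in> I \<longrightarrow> R i x)"
    using assms(2)
  proof (induction rule: finite_induct)
    case definable
    show ?case by (intro definable_intros)
  next
    case empty
    show ?case by (auto intro: AE_I)
  next
    case (insert j I)
    show ?case
    proof
      assume *: "\<forall>i. i \<^bold>\<in> Insert j I \<longrightarrow> (AE x. R i x)"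
      then have "AE x. (\<forall>i. i \<^bold>\<in> I \<longrightarrow> R i x) \<and> R j x" using insert by (intro AE_conj) auto
      then show "AE x. \<forall>i. i \<^bold>\<in> Insert j I \<longrightarrow> R i x" by (rule AE_mp) auto
    qed
  qed
  then show ?thesis using assms(3) by blast
qed

lemma ex_n_subset:
  assumes P: "definable (\<lambda>e. P (e 0))" and "AE x. P x" and "n \<^bold>\<in> \<omega>"
  obtains u where "equipotent u n" "subset u X" "\<And>x. x \<^bold>\<in> u \<Longrightarrow> P x"
proof -
  note [definable_intros] = definable_rel1[where R = P, OF P]
  have "\<exists>u. equipotent u n \<and> subset u X \<and> (\<forall>x. x \<^bold>\<in> u \<longrightarrow> P x)"
    using assms(3)
  proof (induction rule: omega_induct)
    case definable
    show ?case by (intro definable_intros)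
  next
    case zero
    show ?case by (auto simp: subset_def)
  next
    case (succ n)
    then obtain u where u: "equipotent u n" "subset u X" "\<And>x. x \<^bold>\<in> u \<Longrightarrow> P x" by blast
    then have "is_finite u" using succ is_finite_iff by blast
    then obtain x where "x \<^bold>\<in> X" "\<not> x \<^bold>\<in> u" "P x"
      using AE_ex[OF AE_conj[OF AE_not_mem assms(2)]] by blast
    then show ?case using u equipotent_Insert[OF u(1), of x n]
      by (intro exI[of _ "Insert x u"]) (auto simp: subset_def)
  qed
  then show ?thesis using that by blast
qed

text \<open>
  Let \<open>r(y)\<close> be the number of values of \<open>f\<close> below \<open>f(y)\<close>. If \<open>f\<close> is unbounded, passing from a value to the
  next one changes the parity of \<open>r\<close>, so both parities occur outside every finite set, and
  the dichotomy for the class ``\<open>r(y)\<close> is even'' fails.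
\<close>

lemma AE_bounded:
  assumes f: "definable (\<lambda>e. e 0 = f (e (Suc 0)))" and f_omega: "\<And>y. y \<^bold>\<in> X \<Longrightarrow> f y \<^bold>\<in> \<omega>"
  shows "\<exists>n. n \<^bold>\<in> \<omega> \<and> (AE y. f y \<^bold>\<in> n)"
proof (rule ccontr)
  assume *: "\<not> ?thesis"
  note [definable_intros] = definable_term_fun1[where f = f, OF f]
  have large: "AE y. \<not> f y \<^bold>\<in> n" if "n \<^bold>\<in> \<omega>" for n
  proof -
    have "(AE y. f y \<^bold>\<in> n) \<or> (AE y. \<not> f y \<^bold>\<in> n)" by (rule AE_cases) (intro definable_intros)
    then show ?thesis using * that by blast
  qed
  define V where "V y = Coll (f y) (\<lambda>k. \<exists>z. z \<^bold>\<in> X \<and> f z = k)" for y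
  have V: "k \<^bold>\<in> V y \<longleftrightarrow> k \<^bold>\<in> f y \<and> (\<exists>z. z \<^bold>\<in> X \<and> f z = k)" for k y
    unfolding V_def by (rule mem_Coll) (intro definable_intros)
  have finite_V: "is_finite (V y)" if "y \<^bold>\<in> X" for y
    using finite_nat[OF f_omega[OF that]] by (rule finite_subset) (simp add: subset_def V)
  have bounded: "\<exists>n. n \<^bold>\<in> \<omega> \<and> (\<forall>y. y \<^bold>\<in> F \<and> y \<^bold>\<in> X \<longrightarrow> f y \<^bold>\<in> n)" if "is_finite F" for F
    using that
  proof (induction rule: finite_induct)
    case definable
    show ?case by (intro definable_intros)
  next
    case empty
    show ?case by (intro exI[of _ Emp]) simp
  next
    case (insert y F)
    then obtain n where n: "n \<^bold>\<in> \<omega>" "\<And>z. z \<^bold>\<in> F \<Longrightarrow> z \<^bold>\<in> X \<Longrightarrow> f z \<^bold>\<in> n" by blast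
    show ?case
    proof (cases "y \<^bold>\<in> X \<and> \<not> f y \<^bold>\<in> n")
      case True
      then have y: "succ (f y) \<^bold>\<in> \<omega>" "n = f y \<or> n \<^bold>\<in> f y"
        using omega_linear[OF n(1) f_omega] f_omega by auto
      have "f z \<^bold>\<in> succ (f y)" if "z \<^bold>\<in> F" "z \<^bold>\<in> X" for z
        using n(2)[OF that] y nat_transitive[of "f y" n "f z"] True f_omega by auto
      then show ?thesis using y(1) by (intro exI[of _ "succ (f y)"]) auto
    next
      case False
      then show ?thesis using n by (intro exI[of _ n]) auto
    qed
  qed
  have no_parity: False if ae: "AE y. is_even (card (V y)) \<longleftrightarrow> b" for b
  proof -
    obtain F where F: "is_finite F" "\<And>y. y \<^bold>\<in> X \<Longrightarrow> \<not> y \<^bold>\<in> F \<Longrightarrow> is_even (card (V y)) \<longleftrightarrow> b"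
      using ae unfolding AE_def by blast
    obtain n where n: "n \<^bold>\<in> \<omega>" "\<And>y. y \<^bold>\<in> F \<Longrightarrow> y \<^bold>\<in> X \<Longrightarrow> f y \<^bold>\<in> n"
      using bounded[OF F(1)] by blast
    obtain y0 where y0: "y0 \<^bold>\<in> X" "\<not> f y0 \<^bold>\<in> n" using AE_ex[OF large[OF n(1)]] by blast
    have "succ (f y0) \<^bold>\<in> \<omega>" using f_omega y0 by simp
    then obtain z where z: "z \<^bold>\<in> X" "\<not> f z \<^bold>\<in> succ (f y0)" using AE_ex[OF large] by blast
    then have "f y0 \<^bold>\<in> f z" using omega_linear[of "f y0" "f z"] f_omega y0 by auto
    \<comment> \<open>The least value of \<open>f\<close> above \<open>f y0\<close>.\<close>
    obtain m where m: "m \<^bold>\<in> \<omega>" "\<exists>z. z \<^bold>\<in> X \<and> f z = m \<and> f y0 \<^bold>\<in> m"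
      "\<And>k. k \<^bold>\<in> m \<Longrightarrow> \<not> (\<exists>z. z \<^bold>\<in> X \<and> f z = k \<and> f y0 \<^bold>\<in> k)"
    proof (rule least_number[where P = "\<lambda>k. \<exists>z. z \<^bold>\<in> X \<and> f z = k \<and> f y0 \<^bold>\<in> k" and n = "f z"])
      show "definable (\<lambda>e. \<exists>z. z \<^bold>\<in> X \<and> f z = e 0 \<and> f y0 \<^bold>\<in> e 0)" by (intro definable_intros)
    qed (use z f_omega \<open>f y0 \<^bold>\<in> f z\<close> in blast)+
    then obtain y1 where y1: "y1 \<^bold>\<in> X" "f y1 = m" "f y0 \<^bold>\<in> m" by blast
    have "V y1 = Insert (f y0) (V y0)"
    proof (rule set_eqI)
      fix k
      have "k \<^bold>\<in> f y0 \<or> k = f y0" if "k \<^bold>\<in> m" "z \<^bold>\<in> X" "f z = k" for z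
        using m(3)[OF that(1)] that f_omega[OF that(2)] f_omega[OF y0(1)] omega_linear[of k "f y0"] by blast
      moreover have "k \<^bold>\<in> m" if "k \<^bold>\<in> f y0" using nat_transitive[OF m(1) y1(3) that] .
      ultimately show "k \<^bold>\<in> V y1 \<longleftrightarrow> k \<^bold>\<in> Insert (f y0) (V y0)"
        using y0 y1 by (auto simp: V)
    qed
    then have "card (V y1) = succ (card (V y0))"
      using card_Insert finite_V y0 V by simp
    then have "is_even (card (V y1)) \<longleftrightarrow> \<not> is_even (card (V y0))"
      using is_even_succ by simp
    moreover have "\<not> y0 \<^bold>\<in> F" using y0 n by blast
    moreover have "\<not> y1 \<^bold>\<in> F" using y0(2) y1 n nat_transitive[of n m "f y0"] by blast
    ultimately show False using F(2) y0 y1 by blast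
  qed
  have "definable (\<lambda>e. is_even (card (V (e 0))))" unfolding V_def by (intro definable_intros)
  then have "(AE y. is_even (card (V y))) \<or> (AE y. \<not> is_even (card (V y)))" by (rule AE_cases)
  then show False using no_parity[of True] no_parity[of False] by auto
qed

text \<open>
  If it fails, then for almost all \<open>y\<close> the set \<open>V y\<close> of the \<open>x\<close> related to \<open>y\<close> is finite, and by
  \<open>AE_bounded\<close> it has fewer than \<open>n\<close> elements for a fixed \<open>n\<close>. But \<open>n\<close> elements \<open>x\<close> that are each related to almost
  all \<open>y\<close> are all related to a common such \<open>y\<close>.
\<close>

lemma AE_commute:
  assumes R: "definable (\<lambda>e. R (e 0) (e (Suc 0)))" and ae: "AE x. AE y. R x y"
  shows "AE y. AE x. R x y"
proof (rule ccontr)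
  assume *: "\<not> ?thesis"
  note [definable_intros] = definable_rel2[where R = R, OF R]
  have "(AE y. AE x. R x y) \<or> (AE y. \<not> (AE x. R x y))" by (rule AE_cases) (intro definable_intros)
  then have "AE y. \<not> (AE x. R x y)" using * by blast
  then have neg: "AE y. AE x. \<not> R x y"
  proof (rule AE_mp)
    fix y assume "\<not> (AE x. R x y)"
    moreover have "(AE x. R x y) \<or> (AE x. \<not> R x y)" by (rule AE_cases) (intro definable_intros)
    ultimately show "AE x. \<not> R x y" by blast
  qed
  define V where "V y = Coll X (\<lambda>x. R x y)" for y
  have V: "x \<^bold>\<in> V y \<longleftrightarrow> x \<^bold>\<in> X \<and> R x y" for x y
    unfolding V_def by (rule mem_Coll) (intro definable_intros)
  have "definable (\<lambda>e. e 0 = card (V (e (Suc 0))))" unfolding V_def by (intro definable_intros)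
  then obtain n where n: "n \<^bold>\<in> \<omega>" "AE y. card (V y) \<^bold>\<in> n"
    using AE_bounded[of "\<lambda>y. card (V y)"] by auto
  obtain u where u: "equipotent u n" "subset u X" "\<And>x. x \<^bold>\<in> u \<Longrightarrow> AE y. R x y"
  proof (rule ex_n_subset[OF _ ae n(1)])
    show "definable (\<lambda>e. AE y. R (e 0) y)" by (intro definable_intros)
  qed blast
  have "is_finite u" using u(1) n(1) is_finite_iff by blast
  then have "AE y. \<forall>x. x \<^bold>\<in> u \<longrightarrow> R x y" using AE_finite_all[OF R] u(3) by blast
  then obtain y where y: "\<And>x. x \<^bold>\<in> u \<Longrightarrow> R x y" "card (V y) \<^bold>\<in> n" "AE x. \<not> R x y"
    using AE_ex[OF AE_conj[OF _ AE_conj[OF n(2) neg]]] by blast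
  have "is_finite (V y)" unfolding V_def by (rule finite_of_AE_not[OF _ y(3)]) (intro definable_intros)
  moreover have "subset u (V y)" using u(2) y(1) by (auto simp: subset_def V)
  moreover have "card u = n" using card_eqI n(1) u(1) by blast
  ultimately have "n \<^bold>\<in> card (V y) \<or> n = card (V y)" using card_psubset by metis
  then show False using y(2) nat_transitive[OF n(1)] by (metis not_mem_self)
qed

end

context ZF
begin

lemma equipotent_two_iff:
  "equipotent u (succ (succ Emp)) \<longleftrightarrow> (\<exists>x y. x \<noteq> y \<and> u = Insert x (Insert y Emp))"
proof
  assume "equipotent u (succ (succ Emp))"
  then obtain x v y where "\<not> x \<^bold>\<in> v" "u = Insert x v" "v = Insert y Emp"
    using equipotent_succ_iff equipotent_Emp_iff by metis
  then show "\<exists>x y. x \<noteq> y \<and> u = Insert x (Insert y Emp)"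
    by (intro exI[of _ x] exI[of _ y]) auto
qed (auto intro!: equipotent_Insert)

lemma Insert_commute: "Insert x (Insert y a) = Insert y (Insert x a)"
  by (auto intro: set_eqI)

section \<open>Transversals of least size\<close>

text \<open>
  The members of \<open>G\<close> all have the same finite size, and every proper subset \<open>s\<close> of one of them misses a finite
  ``edge'' \<open>d\<close> which all members of \<open>G\<close> meet. Enumerate the members by branching: to extend \<open>s\<close> to a
  member, one of the finitely many elements of \<open>d\<close> must be added, and after \<open>m\<close> additions the member
  is complete. The induction is on the number \<open>j\<close> of elements still missing from \<open>s\<close>.
\<close>

lemma finite_Union_least_transversals:
  assumes G: "definable (\<lambda>e. G (e 0))" and m: "m \<^bold>\<in> \<omega>"
    and card_G: "\<And>t. G t \<Longrightarrow> is_finite t \<and> card t = m"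
    and edge: "\<And>s t. G t \<Longrightarrow> subset s t \<Longrightarrow> s \<noteq> t \<Longrightarrow>
      \<exists>d. is_finite d \<and> (\<forall>p. p \<^bold>\<in> d \<longrightarrow> \<not> p \<^bold>\<in> s) \<and> (\<forall>t'. G t' \<longrightarrow> (\<exists>p. p \<^bold>\<in> d \<and> p \<^bold>\<in> t'))"
  shows "is_finite (Coll a (\<lambda>y. \<exists>t. G t \<and> y \<^bold>\<in> t))"
proof -
  note [definable_intros] = definable_rel1[where R = G, OF G]
  define W where "W s = Coll a (\<lambda>y. \<exists>t. G t \<and> subset s t \<and> y \<^bold>\<in> t)" for s
  have W: "y \<^bold>\<in> W s \<longleftrightarrow> y \<^bold>\<in> a \<and> (\<exists>t. G t \<and> subset s t \<and> y \<^bold>\<in> t)" for s y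
    unfolding W_def by (rule mem_Coll) (intro definable_intros)
  have "\<forall>s. is_finite s \<and> (\<forall>t. G t \<and> subset s t \<longrightarrow> card (Diff t s) = j) \<longrightarrow> is_finite (W s)"
    if "j \<^bold>\<in> \<omega>" for j
    using that
  proof (induction rule: omega_induct)
    case definable
    show ?case unfolding W_def by (intro definable_intros)
  next
    case zero
    show ?case
    proof (intro allI impI, elim conjE)
      fix s assume s: "is_finite s" "\<forall>t. G t \<and> subset s t \<longrightarrow> card (Diff t s) = Emp"
      have "y \<^bold>\<in> s" if y: "G t" "subset s t" "y \<^bold>\<in> t" for t y
      proof -
        have "is_finite (Diff t s)"
          using card_G[OF y(1)] finite_subset[of t "Diff t s"] by (simp add: subset_def)
        then have "Diff t s = Emp" using equipotent_card[of "Diff t s"] s(2) y by simp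
        then have "\<not> y \<^bold>\<in> Diff t s" by simp
        then show ?thesis using y by simp
      qed
      then have "subset (W s) s" unfolding subset_def W by blast
      then show "is_finite (W s)" using s finite_subset by blast
    qed
  next
    case (succ j)
    show ?case
    proof (intro allI impI, elim conjE)
      fix s assume s: "is_finite s" "\<forall>t. G t \<and> subset s t \<longrightarrow> card (Diff t s) = succ j"
      show "is_finite (W s)"
      proof (cases "\<exists>t. G t \<and> subset s t")
        case False
        then have "W s = Emp" by (auto simp: eq_Emp_iff W)
        then show ?thesis by simp
      next
        case True
        then obtain t where t: "G t" "subset s t" by blast
        have "Diff s s = Emp" by (simp add: eq_Emp_iff)
        moreover have "card Emp = Emp" by (rule card_eqI) simp_all
        ultimately have "s \<noteq> t" using s(2) t Insert_neq_Emp by metis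
        then obtain d where d: "is_finite d" "\<And>p. p \<^bold>\<in> d \<Longrightarrow> \<not> p \<^bold>\<in> s"
          "\<And>t'. G t' \<Longrightarrow> \<exists>p. p \<^bold>\<in> d \<and> p \<^bold>\<in> t'" using edge[OF t] by blast
        define V where "V = Coll a (\<lambda>y. \<exists>p. p \<^bold>\<in> d \<and> y \<^bold>\<in> W (Insert p s))"
        have V: "y \<^bold>\<in> V \<longleftrightarrow> y \<^bold>\<in> a \<and> (\<exists>p. p \<^bold>\<in> d \<and> y \<^bold>\<in> W (Insert p s))" for y
          unfolding V_def W_def by (rule mem_Coll) (intro definable_intros)
        have "is_finite V" unfolding V_def
        proof (rule finite_UN[where R = "\<lambda>p y. y \<^bold>\<in> W (Insert p s)"])
          show "definable (\<lambda>e. e (Suc 0) \<^bold>\<in> W (Insert (e 0) s))" unfolding W_def by (intro definable_intros)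
          show "is_finite d" by (fact d(1))
          fix p assume p: "p \<^bold>\<in> d"
          have "card (Diff t (Insert p s)) = j" if t: "G t" "subset (Insert p s) t" for t
          proof -
            have "is_finite (Diff t (Insert p s))"
              using card_G[OF t(1)] finite_subset[of t] by (simp add: subset_def)
            moreover have "Diff t s = Insert p (Diff t (Insert p s))"
              using t(2) d(2)[OF p] by (auto simp: subset_def intro!: set_eqI)
            ultimately have "card (Diff t s) = succ (card (Diff t (Insert p s)))"
              using card_Insert by simp
            moreover have "card (Diff t s) = succ j" using s(2) t by (simp add: subset_def)
            ultimately show ?thesis using succ_inject succ.hyps card_omega by metis
          qed
          then have "is_finite (W (Insert p s))" using succ.IH s(1) finite_Insert by blast
          moreover have "subset (Coll a (\<lambda>y. y \<^bold>\<in> W (Insert p s))) (W (Insert p s))"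
            by (simp add: subset_def mem_Coll definable_intros)
          ultimately show "is_finite (Coll a (\<lambda>y. y \<^bold>\<in> W (Insert p s)))"
            by (rule finite_subset)
        qed
        moreover have "subset (W s) V"
          unfolding subset_def V W using d(3) by (metis mem_Insert subset_def)
        ultimately show ?thesis by (rule finite_subset)
      qed
    qed
  qed
  moreover have "Diff t Emp = t" for t by (auto intro: set_eqI)
  ultimately have "is_finite (W Emp)" using m card_G by simp
  moreover have "subset (Coll a (\<lambda>y. \<exists>t. G t \<and> y \<^bold>\<in> t)) (W Emp)"
    unfolding subset_def W by (subst mem_Coll, intro definable_intros) (auto simp: subset_def)
  ultimately show ?thesis by (rule finite_subset)
qed

end

context amorphous_set
begin

section \<open>Amorphous sets that are finite for pairs\<close>

text \<open>
  Stated for classes, so that colours may be given by formulas; \<open>homogeneous_class\<close> passes from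
  sets to classes by separation.
\<close>

definition homogeneous :: "'a \<Rightarrow> ('a \<Rightarrow> bool) \<Rightarrow> bool" where
  "homogeneous n P \<longleftrightarrow> (\<exists>F. is_finite F \<and>
     ((\<forall>u. subset u (Diff X F) \<and> equipotent u n \<longrightarrow> P u) \<or>
      (\<forall>u. subset u (Diff X F) \<and> equipotent u n \<longrightarrow> \<not> P u)))"

lemma R_infinite_iff: "R_infinite n X \<longleftrightarrow> (\<forall>C. homogeneous n (\<lambda>u. u \<^bold>\<in> C))"
proof
  assume *: "R_infinite n X"
  show "\<forall>C. homogeneous n (\<lambda>u. u \<^bold>\<in> C)"
  proof
    fix C
    obtain y where y: "subset y X" "\<not> is_finite y"
      "(\<forall>u. subset u y \<and> equipotent u n \<longrightarrow> u \<^bold>\<in> C) \<or> (\<forall>u. subset u y \<and> equipotent u n \<longrightarrow> \<not> u \<^bold>\<in> C)"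
      using * unfolding R_infinite_def R_finite_iff by blast
    then obtain F where "is_finite F" "is_complement F X y"
      using amorphous_X unfolding amorphous_def by blast
    then have F: "is_finite F" "subset (Diff X F) y" by (auto simp: is_complement_def subset_def)
    then have "subset u y" if "subset u (Diff X F)" for u using that by (simp add: subset_def)
    then show "homogeneous n (\<lambda>u. u \<^bold>\<in> C)"
      using y(3) F(1) unfolding homogeneous_def by blast
  qed
next
  assume *: "\<forall>C. homogeneous n (\<lambda>u. u \<^bold>\<in> C)"
  have "\<exists>y. subset y X \<and> \<not> is_finite y \<and>
      ((\<forall>u. subset u y \<and> equipotent u n \<longrightarrow> u \<^bold>\<in> C) \<or> (\<forall>u. subset u y \<and> equipotent u n \<longrightarrow> \<not> u \<^bold>\<in> C))" for C
  proof -
    obtain F where F: "is_finite F" "(\<forall>u. subset u (Diff X F) \<and> equipotent u n \<longrightarrow> u \<^bold>\<in> C) \<or>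
      (\<forall>u. subset u (Diff X F) \<and> equipotent u n \<longrightarrow> \<not> u \<^bold>\<in> C)"
      using * unfolding homogeneous_def by blast
    have "subset X (Cup F (Diff X F))" by (simp add: subset_def)
    then have "\<not> is_finite (Diff X F)" using F(1) finite_Cup finite_subset infinite_X by blast
    moreover have "subset (Diff X F) X" by (simp add: subset_def)
    ultimately show ?thesis using F(2) by blast
  qed
  then show "R_infinite n X" unfolding R_infinite_def R_finite_iff by blast
qed

lemma homogeneous_class:
  assumes P: "definable (\<lambda>e. P (e 0))" and hom: "\<forall>C. homogeneous n (\<lambda>u. u \<^bold>\<in> C)"
  shows "homogeneous n P"
proof -
  obtain F where F: "is_finite F" "(\<forall>u. subset u (Diff X F) \<and> equipotent u n \<longrightarrow> u \<^bold>\<in> Coll (Pow X) P) \<or>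
      (\<forall>u. subset u (Diff X F) \<and> equipotent u n \<longrightarrow> \<not> u \<^bold>\<in> Coll (Pow X) P)"
    using hom unfolding homogeneous_def by blast
  have "u \<^bold>\<in> Coll (Pow X) P \<longleftrightarrow> P u" if "subset u (Diff X F)" for u
    using that by (simp add: mem_Coll[OF P] subset_def)
  then show ?thesis using F unfolding homogeneous_def by blast
qed

text \<open>
  \<open>C\<close> is a graph in which almost every vertex has finite degree but no cofinite set is
  independent. The colouring of the larger sets asks for an edge between two vertices of \<open>D\<close>, the vertices
  of finite degree, so that independent sets can be built inside \<open>D\<close> one vertex at a time.
\<close>

lemma colouring_of_sparse_graph:
  assumes sparse: "AE x. AE y. \<not> Insert x (Insert y Emp) \<^bold>\<in> C"
    and edges: "\<And>F. is_finite F \<Longrightarrow> \<exists>x y. x \<noteq> y \<and> x \<^bold>\<in> Diff X F \<and> y \<^bold>\<in> Diff X F \<and> Insert x (Insert y Emp) \<^bold>\<in> C"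
    and k: "k \<^bold>\<in> \<omega>"
  shows "\<not> R_infinite (succ (succ k)) X"
proof
  assume "R_infinite (succ (succ k)) X"
  then have inf: "\<forall>C. homogeneous (succ (succ k)) (\<lambda>u. u \<^bold>\<in> C)" by (simp add: R_infinite_iff)
  define E where "E x y \<longleftrightarrow> Insert x (Insert y Emp) \<^bold>\<in> C" for x y
  have definable_E: "definable (\<lambda>e. E (e 0) (e (Suc 0)))" unfolding E_def by (intro definable_intros)
  note [definable_intros] = definable_rel2[where R = E, OF definable_E]
  have E_sym: "E x y \<longleftrightarrow> E y x" for x y unfolding E_def by (simp add: Insert_commute)
  define D where "D = Coll X (\<lambda>x. AE y. \<not> E x y)"
  have D: "x \<^bold>\<in> D \<longleftrightarrow> x \<^bold>\<in> X \<and> (AE y. \<not> E x y)" for x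
    unfolding D_def by (rule mem_Coll) (intro definable_intros)
  let ?P = "\<lambda>u. \<exists>x y. x \<^bold>\<in> u \<and> y \<^bold>\<in> u \<and> x \<^bold>\<in> D \<and> y \<^bold>\<in> D \<and> x \<noteq> y \<and> E x y"
  have "homogeneous (succ (succ k)) ?P"
    by (rule homogeneous_class[OF _ inf]) (intro definable_intros)
  then obtain F where F: "is_finite F"
    "(\<forall>u. subset u (Diff X F) \<and> equipotent u (succ (succ k)) \<longrightarrow> ?P u) \<or>
     (\<forall>u. subset u (Diff X F) \<and> equipotent u (succ (succ k)) \<longrightarrow> \<not> ?P u)"
    unfolding homogeneous_def by blast
  \<comment> \<open>Removing \<open>X - D\<close> besides \<open>F\<close> leaves only vertices of finite degree.\<close>
  have "AE x. x \<^bold>\<in> D" using sparse by (rule AE_mp) (simp add: D E_def)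
  then have "is_finite (Coll X (\<lambda>x. \<not> x \<^bold>\<in> D))" by (intro finite_of_AE_not definable_intros) simp
  then have G: "is_finite (Cup F (Diff X D))" unfolding Diff_def using F(1) by (intro finite_Cup)
  let ?G = "Cup F (Diff X D)"
  have "\<exists>u. subset u (Diff X F) \<and> equipotent u (succ (succ k)) \<and> ?P u"
  proof -
    obtain x y where xy: "x \<noteq> y" "x \<^bold>\<in> Diff X ?G" "y \<^bold>\<in> Diff X ?G" "E x y"
      using edges[OF G] unfolding E_def by blast
    have "is_finite (Insert x (Insert y F))" using F(1) finite_Insert by blast
    then have "AE z. \<not> z \<^bold>\<in> Insert x (Insert y F)" by (rule AE_not_mem)
    moreover have "definable (\<lambda>e. \<not> e 0 \<^bold>\<in> Insert x (Insert y F))" by (intro definable_intros)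
    ultimately obtain v where v: "equipotent v k" "subset v X" "\<And>z. z \<^bold>\<in> v \<Longrightarrow> \<not> z \<^bold>\<in> Insert x (Insert y F)"
      using ex_n_subset[of "\<lambda>z. \<not> z \<^bold>\<in> Insert x (Insert y F)"] k by blast
    have "equipotent (Insert x (Insert y v)) (succ (succ k))"
      using v xy(1) by (intro equipotent_Insert) auto
    moreover have "subset (Insert x (Insert y v)) (Diff X F)" using v xy by (auto simp: subset_def)
    moreover have "?P (Insert x (Insert y v))" using xy by (intro exI[of _ x] exI[of _ y]) auto
    ultimately show ?thesis by blast
  qed
  moreover have "\<exists>u. subset u (Diff X F) \<and> equipotent u (succ (succ k)) \<and> \<not> ?P u"
  proof -
    have independent: "\<exists>u. equipotent u n \<and> subset u (Diff X ?G) \<and> (\<forall>x y. x \<^bold>\<in> u \<and> y \<^bold>\<in> u \<and> x \<noteq> y \<longrightarrow> \<not> E x y)"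
      if "n \<^bold>\<in> \<omega>" for n
      using that
    proof (induction rule: omega_induct)
      case definable
      show ?case by (intro definable_intros)
    next
      case zero
      show ?case by (intro exI[of _ Emp]) (simp add: subset_def)
    next
      case (succ n)
      then obtain u where u: "equipotent u n" "subset u (Diff X ?G)"
        "\<And>x y. x \<^bold>\<in> u \<Longrightarrow> y \<^bold>\<in> u \<Longrightarrow> x \<noteq> y \<Longrightarrow> \<not> E x y" by blast
      have fin_u: "is_finite u" using u(1) succ.hyps is_finite_iff by blast
      have "AE y. \<not> E x y" if "x \<^bold>\<in> u" for x
        using that u(2) D by (auto simp: subset_def)
      then have "AE y. \<forall>x. x \<^bold>\<in> u \<longrightarrow> \<not> E x y"
        using fin_u by (intro AE_finite_all definable_intros)
      then obtain y where y: "y \<^bold>\<in> X" "\<And>x. x \<^bold>\<in> u \<Longrightarrow> \<not> E x y" "\<not> y \<^bold>\<in> u" "\<not> y \<^bold>\<in> ?G"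
        using AE_ex[OF AE_conj[OF _ AE_conj[OF AE_not_mem[OF fin_u] AE_not_mem[OF G]]]] by blast
      have "equipotent (Insert y u) (succ n)" using u(1) y(3) by (intro equipotent_Insert) auto
      moreover have "subset (Insert y u) (Diff X ?G)" using u(2) y(1,4) by (auto simp: subset_def)
      moreover have "\<forall>x z. x \<^bold>\<in> Insert y u \<and> z \<^bold>\<in> Insert y u \<and> x \<noteq> z \<longrightarrow> \<not> E x z"
        using u(3) y(2) E_sym by auto
      ultimately show ?case by blast
    qed
    obtain u where u: "equipotent u (succ (succ k))" "subset u (Diff X ?G)"
      "\<forall>x y. x \<^bold>\<in> u \<and> y \<^bold>\<in> u \<and> x \<noteq> y \<longrightarrow> \<not> E x y"
      using independent[OF succ_omega[OF succ_omega[OF k]]] by blast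
    then have "subset u (Diff X F)" by (simp add: subset_def)
    then show ?thesis using u by blast
  qed
  ultimately show False using F(2) by blast
qed

text \<open>
  Almost all vertices have finite degree, or almost all have cofinite degree. In the second case the
  complementary graph is sparse.
\<close>

lemma R_finite_of_R_finite_two:
  assumes "\<not> R_infinite (succ (succ Emp)) X" and k: "k \<^bold>\<in> \<omega>"
  shows "\<not> R_infinite (succ (succ k)) X"
proof -
  obtain C where C: "\<not> homogeneous (succ (succ Emp)) (\<lambda>u. u \<^bold>\<in> C)"
    using assms(1) R_infinite_iff by blast
  have pairs: "(\<exists>x y. x \<noteq> y \<and> x \<^bold>\<in> Diff X F \<and> y \<^bold>\<in> Diff X F \<and> Insert x (Insert y Emp) \<^bold>\<in> C) \<and>
      (\<exists>x y. x \<noteq> y \<and> x \<^bold>\<in> Diff X F \<and> y \<^bold>\<in> Diff X F \<and> \<not> Insert x (Insert y Emp) \<^bold>\<in> C)"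
    if "is_finite F" for F
  proof -
    obtain u u' where u: "subset u (Diff X F)" "equipotent u (succ (succ Emp))" "u \<^bold>\<in> C"
      "subset u' (Diff X F)" "equipotent u' (succ (succ Emp))" "\<not> u' \<^bold>\<in> C"
      using C \<open>is_finite F\<close> unfolding homogeneous_def by blast
    then show ?thesis unfolding equipotent_two_iff subset_def using mem_Insert by metis
  qed
  have "(AE x. AE y. \<not> Insert x (Insert y Emp) \<^bold>\<in> C) \<or> (AE x. \<not> (AE y. \<not> Insert x (Insert y Emp) \<^bold>\<in> C))"
    by (rule AE_cases) (intro definable_intros)
  then show ?thesis
  proof
    assume "AE x. AE y. \<not> Insert x (Insert y Emp) \<^bold>\<in> C"
    then show ?thesis by (rule colouring_of_sparse_graph) (use pairs k in blast)+
  next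
    assume dense: "AE x. \<not> (AE y. \<not> Insert x (Insert y Emp) \<^bold>\<in> C)"
    show ?thesis
    proof (rule colouring_of_sparse_graph[of "Diff (Pow X) C"])
      show "AE x. AE y. \<not> Insert x (Insert y Emp) \<^bold>\<in> Diff (Pow X) C"
      proof (rule AE_mp[OF dense])
        fix x assume "\<not> (AE y. \<not> Insert x (Insert y Emp) \<^bold>\<in> C)"
        moreover have "(AE y. Insert x (Insert y Emp) \<^bold>\<in> C) \<or> (AE y. \<not> Insert x (Insert y Emp) \<^bold>\<in> C)"
          by (rule AE_cases) (intro definable_intros)
        ultimately have "AE y. Insert x (Insert y Emp) \<^bold>\<in> C" by blast
        then show "AE y. \<not> Insert x (Insert y Emp) \<^bold>\<in> Diff (Pow X) C" by (rule AE_mp) simp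
      qed
      fix F assume "is_finite F"
      then obtain x y where "x \<noteq> y" "x \<^bold>\<in> Diff X F" "y \<^bold>\<in> Diff X F" "\<not> Insert x (Insert y Emp) \<^bold>\<in> C"
        using pairs by blast
      then show "\<exists>x y. x \<noteq> y \<and> x \<^bold>\<in> Diff X F \<and> y \<^bold>\<in> Diff X F \<and> Insert x (Insert y Emp) \<^bold>\<in> Diff (Pow X) C"
        by (intro exI[of _ x] exI[of _ y]) (auto simp: subset_def)
    qed (fact k)
  qed
qed

section \<open>Amorphous sets that are infinite for pairs\<close>

text \<open>
  The finite sets off which the colour of \<open>{x} \<union> v\<close> is the same for all \<open>n\<close>-sets \<open>v\<close>. Excluding \<open>x\<close> itself
  from \<open>v\<close> makes \<open>{x} \<union> v\<close> an \<open>(n+1)\<close>-set.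
\<close>

definition good :: "'a \<Rightarrow> 'a \<Rightarrow> 'a \<Rightarrow> 'a \<Rightarrow> bool" where
  "good C n x t \<longleftrightarrow> is_finite t \<and>
     ((\<forall>v. subset v (Diff X (Insert x t)) \<and> equipotent v n \<longrightarrow> Insert x v \<^bold>\<in> C) \<or>
      (\<forall>v. subset v (Diff X (Insert x t)) \<and> equipotent v n \<longrightarrow> \<not> Insert x v \<^bold>\<in> C))"

definition least_good :: "'a \<Rightarrow> 'a \<Rightarrow> 'a \<Rightarrow> 'a \<Rightarrow> bool" where
  "least_good C n x t \<longleftrightarrow> good C n x t \<and> (\<forall>t'. good C n x t' \<longrightarrow> \<not> card t' \<^bold>\<in> card t)"

text \<open>
  A canonical substitute for choosing one good set for each \<open>x\<close>: the relation \<open>y \<in> U\<^sub>x\<close>, where \<open>U\<^sub>x\<close> is the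
  union of the good sets of least size.
\<close>

definition dependent :: "'a \<Rightarrow> 'a \<Rightarrow> 'a \<Rightarrow> 'a \<Rightarrow> bool" where
  "dependent C n x y \<longleftrightarrow> (\<exists>t. least_good C n x t \<and> y \<^bold>\<in> t)"

lemma definable_good [definable_intros]:
  "definable_term t \<Longrightarrow> definable_term u \<Longrightarrow> definable (\<lambda>e. good C n (t e) (u e))"
  by (rule definable_rel2[where R = "good C n"], unfold good_def, intro definable_intros)

lemma definable_least_good [definable_intros]:
  "definable_term t \<Longrightarrow> definable_term u \<Longrightarrow> definable (\<lambda>e. least_good C n (t e) (u e))"
  by (rule definable_rel2[where R = "least_good C n"], unfold least_good_def, intro definable_intros)

lemma definable_dependent [definable_intros]:
  "definable_term t \<Longrightarrow> definable_term u \<Longrightarrow> definable (\<lambda>e. dependent C n (t e) (u e))"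
  by (rule definable_rel2[where R = "dependent C n"], unfold dependent_def, intro definable_intros)

lemma ex_least_good:
  assumes "\<forall>C. homogeneous n (\<lambda>u. u \<^bold>\<in> C)"
  obtains t where "least_good C n x t"
proof -
  have "homogeneous n (\<lambda>v. Insert x v \<^bold>\<in> C)"
    by (rule homogeneous_class[OF _ assms]) (intro definable_intros)
  then obtain F where F: "is_finite F" "(\<forall>v. subset v (Diff X F) \<and> equipotent v n \<longrightarrow> Insert x v \<^bold>\<in> C) \<or>
      (\<forall>v. subset v (Diff X F) \<and> equipotent v n \<longrightarrow> \<not> Insert x v \<^bold>\<in> C)"
    unfolding homogeneous_def by blast
  have "subset v (Diff X F)" if "subset v (Diff X (Insert x F))" for v
    using that by (simp add: subset_def)
  then have "good C n x F" using F unfolding good_def by blast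
  then have "\<exists>t. good C n x t \<and> card t = card F" by blast
  then obtain m where m: "\<exists>t. good C n x t \<and> card t = m"
    "\<And>k. k \<^bold>\<in> m \<Longrightarrow> \<not> (\<exists>t. good C n x t \<and> card t = k)"
    by (rule least_number[where P = "\<lambda>k. \<exists>t. good C n x t \<and> card t = k", OF _ card_omega, rotated])
       (auto intro!: definable_intros)
  then show ?thesis using that unfolding least_good_def by metis
qed

text \<open>
  A finite \<open>s\<close> that is not good for \<open>x\<close> leaves two \<open>n\<close>-sets of different colours outside it. Every good set must
  meet their union, which therefore serves as the edge in \<open>finite_Union_least_transversals\<close>.
\<close>

lemma AE_not_dependent:
  assumes hom: "\<forall>C. homogeneous n (\<lambda>u. u \<^bold>\<in> C)" and n: "n \<^bold>\<in> \<omega>"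
  shows "AE y. \<not> dependent C n x y"
proof -
  obtain t0 where t0: "least_good C n x t0" using ex_least_good[OF hom] by blast
  have "is_finite (Coll X (\<lambda>y. \<exists>t. least_good C n x t \<and> y \<^bold>\<in> t))"
  proof (rule finite_Union_least_transversals[where m = "card t0"])
    show "definable (\<lambda>e. least_good C n x (e 0))" by (intro definable_intros)
    show "card t0 \<^bold>\<in> \<omega>" by simp
    show "is_finite t \<and> card t = card t0" if "least_good C n x t" for t
      using that t0 omega_linear[OF card_omega[of t] card_omega[of t0]]
      unfolding least_good_def good_def by blast
    fix s t assume t: "least_good C n x t" and s: "subset s t" "s \<noteq> t"
    have "is_finite t" using t unfolding least_good_def good_def by blast
    then have "is_finite s" "\<not> good C n x s"
      using t card_psubset[OF _ s] finite_subset s(1) unfolding least_good_def by blast+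
    then obtain v v' where v: "subset v (Diff X (Insert x s))" "equipotent v n" "Insert x v \<^bold>\<in> C"
      "subset v' (Diff X (Insert x s))" "equipotent v' n" "\<not> Insert x v' \<^bold>\<in> C"
      unfolding good_def by blast
    have "is_finite v" "is_finite v'" using v n is_finite_iff by blast+
    then have "is_finite (Cup v v')" by (rule finite_Cup)
    moreover have "\<not> p \<^bold>\<in> s" if "p \<^bold>\<in> Cup v v'" for p
      using that v by (auto simp: subset_def)
    moreover have "\<exists>p. p \<^bold>\<in> Cup v v' \<and> p \<^bold>\<in> t'" if "least_good C n x t'" for t'
    proof (rule ccontr)
      assume "\<not> (\<exists>p. p \<^bold>\<in> Cup v v' \<and> p \<^bold>\<in> t')"
      then have "subset v (Diff X (Insert x t'))" "subset v' (Diff X (Insert x t'))"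
        using v(1,4) by (auto simp: subset_def)
      then show False using that v unfolding least_good_def good_def by blast
    qed
    ultimately show "\<exists>d. is_finite d \<and> (\<forall>p. p \<^bold>\<in> d \<longrightarrow> \<not> p \<^bold>\<in> s) \<and>
        (\<forall>t'. least_good C n x t' \<longrightarrow> (\<exists>p. p \<^bold>\<in> d \<and> p \<^bold>\<in> t'))" by blast
  qed
  then have "AE y. \<not> y \<^bold>\<in> Coll X (\<lambda>y. \<exists>t. least_good C n x t \<and> y \<^bold>\<in> t)" by (rule AE_not_mem)
  moreover have "y \<^bold>\<in> Coll X (\<lambda>y. \<exists>t. least_good C n x t \<and> y \<^bold>\<in> t) \<longleftrightarrow> y \<^bold>\<in> X \<and> dependent C n x y" for y
    unfolding dependent_def by (rule mem_Coll) (intro definable_intros)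
  ultimately show ?thesis by (auto elim: AE_mp)
qed

text \<open>
  Off a finite set no \<open>y\<close> depends on another \<open>x\<close>. An \<open>n\<close>-set \<open>v\<close> there avoids every least good set of \<open>x\<close>, so
  the colour of \<open>{x} \<union> v\<close> is decided by \<open>x\<close>.
\<close>

lemma homogeneous_succ:
  assumes two: "\<forall>C. homogeneous (succ (succ Emp)) (\<lambda>u. u \<^bold>\<in> C)"
    and hom: "\<forall>C. homogeneous n (\<lambda>u. u \<^bold>\<in> C)" and n: "n \<^bold>\<in> \<omega>"
  shows "homogeneous (succ n) (\<lambda>u. u \<^bold>\<in> C)"
proof -
  let ?U = "dependent C n"
  let ?P = "\<lambda>u. \<exists>x y. u = Insert x (Insert y Emp) \<and> x \<noteq> y \<and> ?U x y"
  have "homogeneous (succ (succ Emp)) ?P"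
    by (rule homogeneous_class[OF _ two]) (intro definable_intros)
  then obtain F where F: "is_finite F"
    "(\<forall>u. subset u (Diff X F) \<and> equipotent u (succ (succ Emp)) \<longrightarrow> ?P u) \<or>
     (\<forall>u. subset u (Diff X F) \<and> equipotent u (succ (succ Emp)) \<longrightarrow> \<not> ?P u)"
    unfolding homogeneous_def by blast
  have pair: "subset (Insert x (Insert y Emp)) (Diff X F) \<and> equipotent (Insert x (Insert y Emp)) (succ (succ Emp))"
    if "x \<^bold>\<in> Diff X F" "y \<^bold>\<in> Diff X F" "x \<noteq> y" for x y
    using that by (auto simp: subset_def equipotent_two_iff)
  have indep: "\<not> ?U x y" if "x \<^bold>\<in> Diff X F" "y \<^bold>\<in> Diff X F" "x \<noteq> y" for x y
    using F(2)
  proof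
    assume none: "\<forall>u. subset u (Diff X F) \<and> equipotent u (succ (succ Emp)) \<longrightarrow> \<not> ?P u"
    have "\<not> ?P (Insert x (Insert y Emp))" using none pair[OF that] by simp
    then show ?thesis using that(3) by metis
  next
    assume all: "\<forall>u. subset u (Diff X F) \<and> equipotent u (succ (succ Emp)) \<longrightarrow> ?P u"
    \<comment> \<open>A complete graph has \<open>x \<in> U\<^sub>y\<close> for almost all \<open>y\<close>, because \<open>U\<^sub>x\<close> is finite.\<close>
    have ae: "AE y. ?U y x" if x: "x \<^bold>\<in> Diff X F" for x
    proof -
      have "AE y. \<not> ?U x y \<and> \<not> y \<^bold>\<in> Insert x F"
        using AE_not_dependent[OF hom n] AE_not_mem finite_Insert F(1) by (intro AE_conj) blast+
      then show ?thesis
      proof (rule AE_mp)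
        fix y assume y: "y \<^bold>\<in> X" "\<not> ?U x y \<and> \<not> y \<^bold>\<in> Insert x F"
        then have "?P (Insert x (Insert y Emp))" using all pair[of x y] x by auto
        then obtain a b where ab: "Insert x (Insert y Emp) = Insert a (Insert b Emp)" "a \<noteq> b" "?U a b" by blast
        have "z = x \<or> z = y \<longleftrightarrow> z = a \<or> z = b" for z
          using arg_cong[OF ab(1), of "\<lambda>w. z \<^bold>\<in> w"] by simp
        then show "?U y x" using ab(2,3) y(2) by metis
      qed
    qed
    have "AE x. \<not> x \<^bold>\<in> F" using F(1) by (rule AE_not_mem)
    then have "AE x. AE y. ?U y x" by (rule AE_mp) (simp add: ae)
    then have "AE y. AE x. ?U y x" by (rule AE_commute[rotated]) (intro definable_intros)
    then obtain y where "AE x. ?U y x" by (rule AE_ex)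
    then have "AE x. False" using AE_not_dependent[OF hom n, of C y] AE_conj AE_mp by blast
    then show ?thesis using AE_ex by blast
  qed
  let ?A = "\<lambda>x. \<forall>v. subset v (Diff X (Insert x F)) \<and> equipotent v n \<longrightarrow> Insert x v \<^bold>\<in> C"
  let ?B = "\<lambda>x. \<forall>v. subset v (Diff X (Insert x F)) \<and> equipotent v n \<longrightarrow> \<not> Insert x v \<^bold>\<in> C"
  have AB: "?A x \<or> ?B x" if x: "x \<^bold>\<in> Diff X F" for x
  proof -
    obtain t where t: "least_good C n x t" using ex_least_good[OF hom] by blast
    have "subset v (Diff X (Insert x t))" if v: "subset v (Diff X (Insert x F))" for v
      unfolding subset_def
    proof (intro allI impI)
      fix y assume "y \<^bold>\<in> v"
      then have y: "y \<^bold>\<in> X" "y \<noteq> x" "\<not> y \<^bold>\<in> F" using v by (auto simp: subset_def)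
      then have "\<not> ?U x y" using indep x by simp
      then have "\<not> y \<^bold>\<in> t" using t unfolding dependent_def by blast
      then show "y \<^bold>\<in> Diff X (Insert x t)" using y by simp
    qed
    then show ?thesis using t unfolding least_good_def good_def by blast
  qed
  have "(AE x. ?A x) \<or> (AE x. \<not> ?A x)" by (rule AE_cases) (intro definable_intros)
  moreover have "AE x. \<not> x \<^bold>\<in> F" using F(1) by (rule AE_not_mem)
  ultimately have "(AE x. ?A x) \<or> (AE x. ?B x)"
    using AE_mp[OF AE_conj[of "\<lambda>x. \<not> x \<^bold>\<in> F" "\<lambda>x. \<not> ?A x"], of ?B] AB by auto
  then obtain F' where F': "is_finite F'"
    "(\<forall>x. x \<^bold>\<in> X \<and> \<not> x \<^bold>\<in> F' \<longrightarrow> ?A x) \<or> (\<forall>x. x \<^bold>\<in> X \<and> \<not> x \<^bold>\<in> F' \<longrightarrow> ?B x)"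
    unfolding AE_def by blast
  have split: "\<exists>x v. x \<^bold>\<in> X \<and> \<not> x \<^bold>\<in> F' \<and> subset v (Diff X (Insert x F)) \<and> equipotent v n \<and> u = Insert x v"
    if u: "subset u (Diff X (Cup F F'))" "equipotent u (succ n)" for u
  proof -
    obtain x v where x: "\<not> x \<^bold>\<in> v" "u = Insert x v" "equipotent v n"
      using u(2) equipotent_succ_iff by blast
    then have "x \<^bold>\<in> X \<and> \<not> x \<^bold>\<in> F' \<and> subset v (Diff X (Insert x F))"
      using u(1) by (auto simp: subset_def)
    then show ?thesis using x by blast
  qed
  show ?thesis unfolding homogeneous_def
  proof (intro exI conjI)
    show "is_finite (Cup F F')" using F(1) F'(1) by (rule finite_Cup)
    show "(\<forall>u. subset u (Diff X (Cup F F')) \<and> equipotent u (succ n) \<longrightarrow> u \<^bold>\<in> C) \<or>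
        (\<forall>u. subset u (Diff X (Cup F F')) \<and> equipotent u (succ n) \<longrightarrow> \<not> u \<^bold>\<in> C)"
      using F'(2) split by metis
  qed
qed

text \<open>
  Starting at \<open>n = 0\<close>, where only one set is coloured, makes \<open>n = 1\<close> an instance of the induction step.
\<close>

lemma homogeneous_all:
  assumes two: "\<forall>C. homogeneous (succ (succ Emp)) (\<lambda>u. u \<^bold>\<in> C)" and "n \<^bold>\<in> \<omega>"
  shows "\<forall>C. homogeneous n (\<lambda>u. u \<^bold>\<in> C)"
  using assms(2)
proof (induction rule: omega_induct)
  case definable
  show ?case unfolding homogeneous_def by (intro definable_intros)
next
  case zero
  have "homogeneous Emp (\<lambda>u. u \<^bold>\<in> C)" for C
    unfolding homogeneous_def by (intro exI[of _ Emp]) auto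
  then show ?case by blast
next
  case (succ k)
  then show ?case using homogeneous_succ[OF two] by blast
qed

lemma R_dichotomy:
  "(\<forall>n. in_N n \<and> \<not> is_one n \<longrightarrow> R_finite n X) \<or> (\<forall>n. in_N n \<longrightarrow> R_infinite n X)"
proof (cases "R_infinite (succ (succ Emp)) X")
  case True
  then have "R_infinite n X" if "in_N n" for n
    using homogeneous_all that by (simp add: R_infinite_iff in_N_def in_omega_iff)
  then show ?thesis by blast
next
  case False
  have "R_finite n X" if n: "in_N n" "\<not> is_one n" for n
  proof -
    have "n \<^bold>\<in> \<omega>" "n \<noteq> Emp" "n \<noteq> succ Emp"
      using n by (auto simp: in_N_def in_omega_iff is_empty_iff is_one_iff)
    then obtain k where "k \<^bold>\<in> \<omega>" "n = succ (succ k)" by (metis omega_cases)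
    then show ?thesis using R_finite_of_R_finite_two[OF False] R_infinite_def by blast
  qed
  then show ?thesis by blast
qed

end

theorem theorem2p10:
  fixes mem :: "'m \<Rightarrow> 'm \<Rightarrow> bool" and X :: 'm
  assumes "ZF mem" and "set_structure.amorphous mem X"
  shows "(\<forall>n. set_structure.in_N mem n \<and> \<not> set_structure.is_one mem n
              \<longrightarrow> set_structure.R_finite mem n X)
       \<or> (\<forall>n. set_structure.in_N mem n \<longrightarrow> set_structure.R_infinite mem n X)"
proof -
  interpret ZF mem by fact
  interpret amorphous_set mem X by unfold_locales fact
  show ?thesis by (rule R_dichotomy)
qed

end
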